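(* Assume that $\mathsf{E}\{\xi\}=0$ and $\mathsf{E}\{|\xi|^\kappa\}<\infty$ for some $1<\kappa\le 2$. Assume also that $x\mapsto F(x+\Delta)$ is almost decreasing and that $x\mapsto x^\kappa F(x+\Delta)$ either belongs to $\mathcal{S}d$ or is $O$-regularly varying. If furthermore $$\lim_{x\to\infty}\ \sup_{0\le t\le x^{1/\kappa}}\left|\frac{F(x-t+\Delta)}{F(x+\Delta)}-1\right|=0,$$ then for any $a>0$, $$\lim_{n\to\infty}\ \sup_{x\ge a}\left|\frac{\mathsf{P}\{S_n\in nx+\Delta\}}{n\,\mathsf{P}\{\xi_1\in nx+\Delta\}}-1\right|=0 .$$
   Context: Let $\xi,\xi_1,\xi_2,\dots$ be i.i.d. real random variables with distribution $F$, and $S_n=\xi_1+\cdots+\xi_n$. Fix $T\in(0,\infty]$; put $\Delta=(0,T]$ if $T<\infty$ and $\Delta=(0,\infty)$ if $T=\infty$, and $F(x+\Delta)=\mathsf{P}\{\xi\in x+\Delta\}$ (so $F(x+\Delta)=\mathsf{P}\{\xi>x\}$ when $T=\infty$). A function $f$ is almost decreasing if $f(x)\asymp\sup_{y\ge x}f(y)$ as $x\to\infty$, where $f\asymp g$ means $f=O(g)$ and $g=O(f)$. A positive measurable function $f$ defined near infinity is $O$-regularly varying if $0<\liminf_{x\to\infty}f(xy)/f(x)\le\limsup_{x\to\infty}f(xy)/f(x)<\infty$ for every $y\ge1$. A function $H:\mathbb{R}\to[0,\infty)$ belongs to $\mathcal{S}d$ if it is long-tailed (i.e. $H(x)>0$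 for all large $x$ and $H(x+y)\sim H(x)$ as $x\to\infty$ for every $y\in\mathbb{R}$) and $$\lim_{x\to\infty}\frac{\int_0^{x/2}H(y)H(x-y)\,dy}{H(x)}=\int_0^\infty H(y)\,dy<\infty .$$ This property depends only on the restriction of $H$ to the positive half-line. *)

theory Defs
  imports "HOL-Probability.Probability" "HOL-Library.Landau_Symbols"
begin

text \<open>\<open>(0, T]\<close> for finite \<open>T\<close> and \<open>(0, \<infinity>)\<close> for \<open>T = \<infinity>\<close>.\<close>

definition Delta :: "ereal \<Rightarrow> real set" where
  "Delta T = {y. 0 < y \<and> ereal y \<le> T}"

definition shifted_Delta :: "ereal \<Rightarrow> real \<Rightarrow> real set" where
  "shifted_Delta T x = (\<lambda>y. x + y) ` Delta T"

definition local_prob :: "real measure \<Rightarrow> ereal \<Rightarrow> real \<Rightarrow> real" where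
  "local_prob F T x = measure F (shifted_Delta T x)"

text \<open>The boundedness clause makes the real-valued supremum meaningful; it holds
  automatically for \<^term>\<open>local_prob F T\<close> when \<open>F\<close> is a probability measure.\<close>

definition almost_decreasing :: "(real \<Rightarrow> real) \<Rightarrow> bool" where
  "almost_decreasing f \<longleftrightarrow>
     (\<forall>\<^sub>F x in at_top. bdd_above (f ` {x..})) \<and>
     f \<in> \<Theta>[at_top](\<lambda>x. SUP y\<in>{x..}. f y)"

definition O_regularly_varying :: "(real \<Rightarrow> real) \<Rightarrow> bool" where
  "O_regularly_varying f \<longleftrightarrow>
     (\<exists>A. (\<forall>x\<ge>A. 0 < f x) \<and> f \<in> borel_measurable (restrict_space borel {A..})) \<and>
     (\<forall>y\<ge>1. 0 < Liminf at_top (\<lambda>x. ereal (f (x * y) / f x)) \<and>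
            Limsup at_top (\<lambda>x. ereal (f (x * y) / f x)) < \<infinity>)"

definition long_tailed :: "(real \<Rightarrow> real) \<Rightarrow> bool" where
  "long_tailed H \<longleftrightarrow>
     (\<forall>\<^sub>F x in at_top. 0 < H x) \<and>
     (\<forall>y. (\<lambda>x. H (x + y)) \<sim>[at_top] H)"

text \<open>Finiteness of \<open>\<integral>\<^sub>0\<^sup>\<infinity> H\<close> (and measurability of \<open>H\<close> on the half-line) is the
  \<^const>\<open>set_integrable\<close> clause. A non-integrable convolution integrand would make the
  Bochner integral 0; this cannot happen for arbitrarily large arguments, because the
  limit is strictly positive.\<close>

definition Sd :: "(real \<Rightarrow> real) \<Rightarrow> bool" where
  "Sd H \<longleftrightarrow>
     (\<forall>x. 0 \<le> H x) \<and> long_tailed H \<and>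
     set_integrable lborel {0..} H \<and>
     ((\<lambda>x. (LBINT y:{0..x / 2}. H y * H (x - y)) / H x)
        \<longlongrightarrow> (LBINT y:{0..}. H y)) at_top"

end

theory Submission
  imports Defs "HOL-Real_Asymp.Real_Asymp"
begin

text \<open>
  Cut the steps at the natural scale \<open>h = n\<^sup>1\<^sup>/\<^sup>\<kappa>\<close>. Writing \<open>F = \<mu> + \<nu>\<close> with \<open>\<mu>\<close> carried by \<open>(-\<infinity>, h]\<close>
  and \<open>\<nu>\<close> by \<open>(h, \<infinity>)\<close>, convolution powers satisfy
  \<open>n \<nu>\<mu>\<^sup>n\<^sup>-\<^sup>1 \<le> F\<^sup>n \<le> \<mu>\<^sup>n + n \<nu>\<mu>\<^sup>n\<^sup>-\<^sup>1 + n\<^sup>2 \<nu>\<^sup>2F\<^sup>n\<^sup>-\<^sup>2\<close>.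
  Since \<open>e\<^sup>u \<le> 1 + u + |u|\<^sup>\<kappa>\<close> for \<open>u \<le> 1\<close>, the exponential moments of \<open>\<mu>\<^sup>j\<close> at \<open>1/h\<close> stay bounded for
  \<open>j \<le> n\<close>, while insensitivity forces \<open>ln F(x + \<Delta>)\<close> to vary by \<open>o(1)\<close> over distances of order \<open>h\<close>
  and \<open>F(z + \<Delta>)\<close> to decay more slowly than \<open>exp(-\<theta> z\<^sup>1\<^sup>-\<^sup>1\<^sup>/\<^sup>\<kappa>)\<close> for every \<open>\<theta> > 0\<close>. Hence the term without
  large jumps is negligible and the term with one large jump is \<open>n F(z + \<Delta>)(1 + o(1))\<close>. Two large
  jumps are negligible because \<open>\<nu>\<^sup>2(x + \<Delta>) = o(1/n) \<nu>(x + \<Delta>)\<close> uniformly in \<open>x\<close>, which is where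
  \<open>Sd\<close> or \<open>O\<close>-regular variation enters.
\<close>

subsection \<open>Restricted convolution operators\<close>

text \<open>Truncating from above only is enough: the bound for e^u is integrated over the whole
  line, where the mean vanishes, and h^\<kappa> = n makes n steps cost at most the factor
  exp(E|xi|^\<kappa>). What shapes the proof is uniformity. The two-jump term still contains n - 2
  untruncated steps, so the two-jump estimate has to survive convolution with a power of F. It is
  therefore a pointwise inequality between functions of x on the entire line, also below h, and the
  untruncated powers are bounded by an induction that feeds this estimate back into itself. In the
  one-jump term F(w+Delta) may exceed F(z+Delta) by a factor exponential in (z-w)/h; the rate can be
  made at most 1/2, so the exponential moment at 1/h absorbs it. Everything is phrased with
  operators on functions instead of convolved measures: powers are iterates, inequalities become
  pointwise comparisons of test functions, and values in \<open>ennreal\<close> remove integrability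
  conditions.\<close>

definition restricted_conv :: "real measure \<Rightarrow> real set \<Rightarrow> (real \<Rightarrow> ennreal) \<Rightarrow> real \<Rightarrow> ennreal" where
  "restricted_conv F A f x = (\<integral>\<^sup>+y\<in>A. f (x - y) \<partial>F)"

context real_distribution
begin

abbreviation R :: "real set \<Rightarrow> (real \<Rightarrow> ennreal) \<Rightarrow> real \<Rightarrow> ennreal" where
  "R \<equiv> restricted_conv M"

lemma measurable_restricted_conv [measurable]:
  assumes [measurable]: "f \<in> borel_measurable borel" "A \<in> sets borel"
  shows "R A f \<in> borel_measurable borel"
proof -
  have "(\<lambda>x. \<integral>\<^sup>+y. f (x - y) * indicator A y \<partial>M) \<in> borel_measurable borel"
    by measurable
  then show ?thesis
    unfolding restricted_conv_def[abs_def] .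
qed

lemma measurable_restricted_conv_power [measurable]:
  assumes [measurable]: "f \<in> borel_measurable borel" "A \<in> sets borel"
  shows "(R A ^^ n) f \<in> borel_measurable borel"
  by (induction n) auto

section \<open>Monotonicity, linearity and commutation of the operators; expansions of convolution
  powers\<close>

lemma restricted_conv_mono:
  assumes "A \<subseteq> B" "\<And>w. f w \<le> g w"
  shows "R A f x \<le> R B g x"
  unfolding restricted_conv_def
  using assms by (intro nn_integral_mono mult_mono) (auto simp: indicator_def)

lemma restricted_conv_power_mono:
  assumes "A \<subseteq> B" "\<And>w. f w \<le> g w"
  shows "(R A ^^ n) f x \<le> (R B ^^ n) g x"
  using assms(2)
  by (induction n arbitrary: x) (auto intro!: restricted_conv_mono[OF assms(1)])

lemma restricted_conv_add:
  assumes [measurable]: "f \<in> borel_measurable borel" "g \<in> borel_measurable borel" "A \<in> sets borel"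
  shows "R A (\<lambda>w. f w + g w) x = R A f x + R A g x"
  unfolding restricted_conv_def by (simp add: distrib_right nn_integral_add)

lemma restricted_conv_cmult:
  assumes [measurable]: "f \<in> borel_measurable borel" "A \<in> sets borel"
  shows "R A (\<lambda>w. c * f w) x = c * R A f x"
  unfolding restricted_conv_def by (simp add: mult.assoc nn_integral_cmult)

lemma restricted_conv_power_add:
  assumes [measurable]: "f \<in> borel_measurable borel" "g \<in> borel_measurable borel" "A \<in> sets borel"
  shows "(R A ^^ n) (\<lambda>w. f w + g w) x = (R A ^^ n) f x + (R A ^^ n) g x"
proof (induction n arbitrary: x)
  case (Suc n)
  have "(R A ^^ n) (\<lambda>w. f w + g w) = (\<lambda>w. (R A ^^ n) f w + (R A ^^ n) g w)"
    using Suc by auto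
  then show ?case by (simp add: restricted_conv_add)
qed simp

lemma restricted_conv_power_cmult:
  assumes [measurable]: "f \<in> borel_measurable borel" "A \<in> sets borel"
  shows "(R A ^^ n) (\<lambda>w. c * f w) x = c * (R A ^^ n) f x"
proof (induction n arbitrary: x)
  case (Suc n)
  have "(R A ^^ n) (\<lambda>w. c * f w) = (\<lambda>w. c * (R A ^^ n) f w)"
    using Suc by auto
  then show ?case by (simp add: restricted_conv_cmult)
qed simp

lemma restricted_conv_split:
  assumes [measurable]: "f \<in> borel_measurable borel" "A \<in> sets borel"
  shows "R UNIV f x = R A f x + R (- A) f x"
  unfolding restricted_conv_def
  by (subst nn_integral_add[symmetric])
     (auto intro!: nn_integral_cong simp: indicator_def)

text \<open>Commutativity of convolution, by Fubini. It moves a jump to the front from any position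
  among the steps, which is the source of the counting factors in the expansions below.\<close>

lemma restricted_conv_commute:
  assumes [measurable]: "f \<in> borel_measurable borel" "A \<in> sets borel" "B \<in> sets borel"
  shows "R A (R B f) = R B (R A f)"
proof
  fix x
  interpret P: pair_sigma_finite M M ..
  have "R A (R B f) x = (\<integral>\<^sup>+y. \<integral>\<^sup>+w. f (x - y - w) * indicator B w * indicator A y \<partial>M \<partial>M)"
    unfolding restricted_conv_def by (simp add: nn_integral_multc)
  also have "\<dots> = (\<integral>\<^sup>+w. \<integral>\<^sup>+y. f (x - y - w) * indicator B w * indicator A y \<partial>M \<partial>M)"
    by (rule P.Fubini') measurable
  also have "\<dots> = (\<integral>\<^sup>+w. \<integral>\<^sup>+y. f (x - w - y) * indicator A y * indicator B w \<partial>M \<partial>M)"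
    by (intro nn_integral_cong) (simp add: mult_ac algebra_simps)
  also have "\<dots> = R B (R A f) x"
    unfolding restricted_conv_def by (simp add: nn_integral_multc)
  finally show "R A (R B f) x = R B (R A f) x" .
qed

lemma restricted_conv_power_commute:
  assumes [measurable]: "f \<in> borel_measurable borel" "A \<in> sets borel" "B \<in> sets borel"
  shows "(R A ^^ n) (R B f) = R B ((R A ^^ n) f)"
  by (induction n) (simp_all add: restricted_conv_commute)

lemma restricted_conv_power_const:
  "(R UNIV ^^ n) (\<lambda>w. c) x = c"
proof (induction n arbitrary: x)
  case (Suc n)
  have "(R UNIV ^^ n) (\<lambda>w. c) = (\<lambda>w. c)" using Suc by auto
  moreover have "R UNIV (\<lambda>w. c) x = c"
    using emeasure_space_1 by (simp add: restricted_conv_def)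
  ultimately show ?case by simp
qed simp

text \<open>Either all steps lie in \<open>A\<close>, or some step lies outside it; a union bound
  over the position of that step gives the factor \<open>Suc n\<close>. In the induction a further
  step in \<open>A\<close> is commuted past the jump and then enlarged to an arbitrary step.\<close>

lemma conv_power_le:
  assumes [measurable]: "f \<in> borel_measurable borel" "A \<in> sets borel"
  shows "(R UNIV ^^ Suc n) f x
    \<le> (R A ^^ Suc n) f x + of_nat (Suc n) * R (- A) ((R UNIV ^^ n) f) x"
proof (induction n arbitrary: x)
  case 0
  then show ?case by (simp add: restricted_conv_split[of f A])
next
  case (Suc n)
  let ?g = "(R UNIV ^^ Suc n) f"
  have "(R UNIV ^^ Suc (Suc n)) f x = R A ?g x + R (- A) ?g x"
    using restricted_conv_split[of ?g A] by simp
  also have "R A ?g x \<le> R A (\<lambda>w. (R A ^^ Suc n) f w + of_nat (Suc n) * R (- A) ((R UNIV ^^ n) f) w) x"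
    by (rule restricted_conv_mono[OF _ Suc]) simp
  also have "\<dots> = (R A ^^ Suc (Suc n)) f x + of_nat (Suc n) * R A (R (- A) ((R UNIV ^^ n) f)) x"
    by (simp add: restricted_conv_add restricted_conv_cmult del: of_nat_Suc)
  also have "R A (R (- A) ((R UNIV ^^ n) f)) x \<le> R (- A) ?g x"
    by (subst restricted_conv_commute) (auto intro!: restricted_conv_mono)
  finally have "(R UNIV ^^ Suc (Suc n)) f x
      \<le> (R A ^^ Suc (Suc n)) f x + of_nat (Suc n) * R (- A) ?g x + R (- A) ?g x"
    by (simp add: add_right_mono add_left_mono mult_left_mono del: of_nat_Suc funpow.simps)
  then show ?case by (simp add: distrib_right add_ac del: funpow.simps)
qed

text \<open>Classifies by zero, one or at least two steps outside \<open>A\<close>. The first two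
  cases are kept exactly as in the binomial expansion; only in the last are the remaining steps left
  unrestricted, at the price of counting pairs of positions generously.\<close>

lemma conv_power_le2:
  assumes [measurable]: "f \<in> borel_measurable borel" "A \<in> sets borel"
  shows "(R UNIV ^^ Suc (Suc n)) f x
    \<le> (R A ^^ Suc (Suc n)) f x + of_nat (Suc (Suc n)) * R (- A) ((R A ^^ Suc n) f) x
      + of_nat (Suc (Suc n)) ^ 2 * R (- A) (R (- A) ((R UNIV ^^ n) f)) x"
proof -
  \<comment> \<open>At n = 0 the power \<open>n - 1\<close> is truncated to 0, which is harmless
    because its coefficient vanishes there.\<close>
  have *: "(R UNIV ^^ Suc n) f x
    \<le> (R A ^^ Suc n) f x + of_nat (Suc n) * R (- A) ((R A ^^ n) f) x
      + of_nat (n * Suc n) * R (- A) (R (- A) ((R UNIV ^^ (n - 1)) f)) x" for n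
  proof (induction n arbitrary: x)
    case 0
    then show ?case by (simp add: restricted_conv_split[of f A])
  next
    case (Suc n)
    let ?g = "(R UNIV ^^ Suc n) f"
    let ?W = "R (- A) (R (- A) ((R UNIV ^^ n) f)) x"
    have meas [measurable]: "?g \<in> borel_measurable borel"
      by (rule measurable_restricted_conv_power) auto
    have "R A ?g x \<le> R A (\<lambda>w. (R A ^^ Suc n) f w + of_nat (Suc n) * R (- A) ((R A ^^ n) f) w
      + of_nat (n * Suc n) * R (- A) (R (- A) ((R UNIV ^^ (n - 1)) f)) w) x"
      by (rule restricted_conv_mono[OF _ Suc]) simp
    also have "\<dots> = (R A ^^ Suc (Suc n)) f x + of_nat (Suc n) * R A (R (- A) ((R A ^^ n) f)) x
       + of_nat (n * Suc n) * R A (R (- A) (R (- A) ((R UNIV ^^ (n - 1)) f))) x"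
      by (simp add: restricted_conv_add restricted_conv_cmult del: of_nat_Suc of_nat_mult)
    also have "R A (R (- A) ((R A ^^ n) f)) x = R (- A) ((R A ^^ Suc n) f) x"
      by (subst restricted_conv_commute) auto
    also have "of_nat (n * Suc n) * R A (R (- A) (R (- A) ((R UNIV ^^ (n - 1)) f))) x
      \<le> of_nat (n * Suc n) * ?W"
    \<comment> \<open>For n = Suc k the extra step in \<open>A\<close> is absorbed by the
      unrestricted power; for n = 0 the coefficient is 0.\<close>
    proof (cases n)
      case (Suc k)
      have "R A (R (- A) (R (- A) ((R UNIV ^^ k) f))) x
         = R (- A) (R (- A) (R A ((R UNIV ^^ k) f))) x"
        by (simp add: restricted_conv_commute[of _ A "- A"])
      also have "\<dots> \<le> R (- A) (R (- A) (R UNIV ((R UNIV ^^ k) f))) x"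
        by (intro restricted_conv_mono) auto
      finally show ?thesis using Suc by (intro mult_left_mono) auto
    qed simp
    finally have 1: "R A ?g x \<le> (R A ^^ Suc (Suc n)) f x
        + of_nat (Suc n) * R (- A) ((R A ^^ Suc n) f) x + of_nat (n * Suc n) * ?W"
      by (simp add: add_left_mono)
    have "R (- A) ?g x \<le> R (- A) (\<lambda>w. (R A ^^ Suc n) f w
        + of_nat (Suc n) * R (- A) ((R UNIV ^^ n) f) w) x"
      by (rule restricted_conv_mono[OF _ conv_power_le]) auto
    also have "\<dots> = R (- A) ((R A ^^ Suc n) f) x + of_nat (Suc n) * ?W"
      by (simp add: restricted_conv_add restricted_conv_cmult del: of_nat_Suc funpow.simps)
    finally have 2: "R (- A) ?g x \<le> R (- A) ((R A ^^ Suc n) f) x + of_nat (Suc n) * ?W" .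
    have "(R UNIV ^^ Suc (Suc n)) f x = R A ?g x + R (- A) ?g x"
      using restricted_conv_split[of ?g A] by simp
    also have "\<dots> \<le> ((R A ^^ Suc (Suc n)) f x
        + of_nat (Suc n) * R (- A) ((R A ^^ Suc n) f) x + of_nat (n * Suc n) * ?W)
        + (R (- A) ((R A ^^ Suc n) f) x + of_nat (Suc n) * ?W)"
      by (intro add_mono 1 2)
    also have "\<dots> = (R A ^^ Suc (Suc n)) f x
        + of_nat (Suc (Suc n)) * R (- A) ((R A ^^ Suc n) f) x + of_nat (Suc n * Suc n) * ?W"
      by (simp add: distrib_right add_ac del: funpow.simps)
    \<comment> \<open>The recursion adds n + 1 to n(n + 1), giving (n + 1)^2; rounding up to (n +
      1)(n + 2) restores the form of the induction hypothesis.\<close>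
    also have "\<dots> \<le> (R A ^^ Suc (Suc n)) f x
        + of_nat (Suc (Suc n)) * R (- A) ((R A ^^ Suc n) f) x + of_nat (Suc n * Suc (Suc n)) * ?W"
      by (intro add_left_mono mult_right_mono of_nat_mono) auto
    finally show ?case by simp
  qed
  have "of_nat (Suc n * Suc (Suc n)) \<le> (of_nat (Suc (Suc n)) ^ 2 :: ennreal)"
    unfolding of_nat_power[symmetric] by (rule of_nat_mono) (simp add: power2_eq_square)
  then have "of_nat (Suc n * Suc (Suc n)) * R (- A) (R (- A) ((R UNIV ^^ n) f)) x
    \<le> of_nat (Suc (Suc n)) ^ 2 * R (- A) (R (- A) ((R UNIV ^^ n) f)) x"
    by (rule mult_right_mono) simp
  then show ?thesis
    using order_trans[OF *[of "Suc n"] add_left_mono] by simp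
qed

text \<open>The events that exactly the i-th step leaves \<open>A\<close> are disjoint for different
  i, so their contributions add up without loss.\<close>

lemma conv_power_ge:
  assumes [measurable]: "f \<in> borel_measurable borel" "A \<in> sets borel"
  shows "of_nat (Suc n) * R (- A) ((R A ^^ n) f) x \<le> (R UNIV ^^ Suc n) f x"
proof (induction n arbitrary: x)
  case 0
  then show ?case by (simp add: restricted_conv_mono)
next
  case (Suc n)
  let ?g = "(R UNIV ^^ Suc n) f"
  have "of_nat (Suc (Suc n)) * R (- A) ((R A ^^ Suc n) f) x
      = of_nat (Suc n) * R (- A) (R A ((R A ^^ n) f)) x + R (- A) ((R A ^^ Suc n) f) x"
    by (simp add: distrib_right add_ac)
  also have "of_nat (Suc n) * R (- A) (R A ((R A ^^ n) f)) x
      = R A (\<lambda>w. of_nat (Suc n) * R (- A) ((R A ^^ n) f) w) x"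
    by (subst restricted_conv_commute) (simp_all add: restricted_conv_cmult del: of_nat_Suc)
  also have "\<dots> \<le> R A ?g x"
    by (rule restricted_conv_mono[OF _ Suc]) simp
  also have "R (- A) ((R A ^^ Suc n) f) x \<le> R (- A) ?g x"
    by (intro restricted_conv_mono restricted_conv_power_mono) auto
  also have "R A ?g x + R (- A) ?g x = (R UNIV ^^ Suc (Suc n)) f x"
    using restricted_conv_split[of ?g A] by simp
  finally show ?case by (simp add: add_right_mono add_left_mono)
qed

end

subsection \<open>Exponential moments below the truncation level\<close>

text \<open>For |u| \<le> 1 the quadratic bound 1 + u + u^2 suffices, since \<kappa> \<le> 2 gives
  u^2 \<le> |u|^\<kappa>. For u < -1 the right side is already at least 1, since \<kappa> > 1 gives
  |u|^\<kappa> \<ge> -u.\<close>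

lemma exp_le_one_plus_powr:
  fixes u \<kappa> :: real
  assumes "u \<le> 1" "1 < \<kappa>" "\<kappa> \<le> 2"
  shows "exp u \<le> 1 + u + \<bar>u\<bar> powr \<kappa>"
proof -
  have sq: "u\<^sup>2 \<le> \<bar>u\<bar> powr \<kappa>" if "\<bar>u\<bar> \<le> 1"
  proof (cases "u = 0")
    case False
    have "\<bar>u\<bar> powr 2 \<le> \<bar>u\<bar> powr \<kappa>"
      using that assms by (intro powr_mono') auto
    then show ?thesis using False by (simp add: powr_numeral)
  qed simp
  consider "0 \<le> u" | "- 1 \<le> u" "u < 0" | "u < - 1" by linarith
  then show ?thesis
  proof cases
    case 1
    with exp_bound[of u] sq assms show ?thesis by simp
  next
    case 2
    have pos: "0 < 1 - u" using 2 by simp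
    have "exp u = 1 / exp (- u)" by (simp add: exp_minus divide_simps)
    also have "\<dots> \<le> 1 / (1 - u)"
      using 2 exp_ge_add_one_self[of "- u"] by (intro divide_left_mono) auto
    also have "\<dots> \<le> 1 + u + u\<^sup>2"
    proof -
      have "(1 + u + u\<^sup>2) * (1 - u) = 1 + (- u) ^ 3"
        by (simp add: algebra_simps power2_eq_square power3_eq_cube)
      moreover have "0 \<le> (- u) ^ 3" using 2 by (intro zero_le_power) simp
      ultimately show ?thesis using pos by (simp add: divide_simps)
    qed
    also have "\<dots> \<le> 1 + u + \<bar>u\<bar> powr \<kappa>" using sq 2 by simp
    finally show ?thesis .
  next
    case 3
    have "\<bar>u\<bar> powr 1 \<le> \<bar>u\<bar> powr \<kappa>"
      using 3 assms by (intro powr_mono) auto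
    then have "- u \<le> \<bar>u\<bar> powr \<kappa>" using 3 by simp
    moreover have "exp u \<le> 1" using 3 by simp
    ultimately show ?thesis by linarith
  qed
qed

text \<open>The cost of truncating all n steps is the union bound for the event that some step falls
  outside \<open>A\<close>.\<close>

lemma (in real_distribution) conv_power_le_restricted:
  assumes [measurable]: "f \<in> borel_measurable borel" "A \<in> sets borel"
    and le1: "\<And>w. f w \<le> 1"
  shows "(R UNIV ^^ n) f x \<le> (R A ^^ n) f x + of_nat n * emeasure M (- A)"
proof (cases n)
  case (Suc k)
  have [measurable]: "- A \<in> sets M" by simp
  have "(R UNIV ^^ k) f w \<le> 1" for w
    using restricted_conv_power_mono[of UNIV UNIV f "\<lambda>_. 1" k w] le1
    by (simp add: restricted_conv_power_const)
  then have "R (- A) ((R UNIV ^^ k) f) x \<le> R (- A) (\<lambda>_. 1) x"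
    by (intro restricted_conv_mono) auto
  also have "\<dots> = emeasure M (- A)" by (simp add: restricted_conv_def)
  finally have "of_nat (Suc k) * R (- A) ((R UNIV ^^ k) f) x \<le> of_nat (Suc k) * emeasure M (- A)"
    by (intro mult_left_mono) auto
  then show ?thesis
    using order_trans[OF conv_power_le[of f A k x] add_left_mono] Suc by simp
qed simp

locale centered_distribution = real_distribution +
  fixes \<kappa> :: real
  assumes kappa: "1 < \<kappa>" "\<kappa> \<le> 2"
    and moment: "integrable M (\<lambda>x. \<bar>x\<bar> powr \<kappa>)"
    and mean: "expectation (\<lambda>x. x) = 0"
begin

definition m :: real where "m = expectation (\<lambda>x. \<bar>x\<bar> powr \<kappa>)"

lemma m_nonneg: "0 \<le> m"
  unfolding m_def by simp

lemma integrable_id: "integrable M (\<lambda>x. x)"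
proof (rule Bochner_Integration.integrable_bound)
  show "integrable M (\<lambda>x. 1 + \<bar>x\<bar> powr \<kappa>)"
    using moment by simp
  have "\<bar>x\<bar> \<le> 1 + \<bar>x\<bar> powr \<kappa>" for x :: real
  proof (cases "\<bar>x\<bar> \<le> 1")
    case False
    then have "\<bar>x\<bar> powr 1 \<le> \<bar>x\<bar> powr \<kappa>" using kappa by (intro powr_mono) auto
    then show ?thesis using False by simp
  qed (simp add: add_increasing2)
  then show "AE x in M. norm x \<le> norm (1 + \<bar>x\<bar> powr \<kappa>)"
    by (auto intro!: AE_I2 order_trans[OF _ abs_ge_self])
qed simp

text \<open>The linear term is integrated over all of the line, where the mean is 0, so no estimate
  of a truncated mean is required.\<close>

lemma truncated_exp_moment:
  "(\<integral>\<^sup>+y\<in>{y. s * y \<le> 1}. ennreal (exp (s * y)) \<partial>M) \<le> ennreal (1 + \<bar>s\<bar> powr \<kappa> * m)"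
proof -
  let ?g = "\<lambda>y. 1 + s * y + \<bar>s\<bar> powr \<kappa> * \<bar>y\<bar> powr \<kappa>"
  have le: "exp (s * y) \<le> ?g y" if "s * y \<le> 1" for y
    using exp_le_one_plus_powr[OF that kappa] by (simp add: abs_mult powr_mult)
  \<comment> \<open>Nonnegativity off the truncation set is what allows the integral to be extended
    to the whole line.\<close>
  have nonneg: "0 \<le> ?g y" for y
  proof (cases "s * y \<le> 1")
    case True
    then show ?thesis using le[OF True] exp_ge_zero order_trans by blast
  qed (simp add: add_nonneg_nonneg)
  have int: "integrable M ?g" using moment integrable_id by simp
  have "(\<integral>\<^sup>+y\<in>{y. s * y \<le> 1}. ennreal (exp (s * y)) \<partial>M) \<le> (\<integral>\<^sup>+y. ennreal (?g y) \<partial>M)"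
    using le nonneg by (intro nn_integral_mono) (auto simp: indicator_def intro: ennreal_leI)
  also have "\<dots> = ennreal (\<integral>y. ?g y \<partial>M)"
    using int nonneg by (intro nn_integral_eq_integral) auto
  also have "(\<integral>y. ?g y \<partial>M) = 1 + \<bar>s\<bar> powr \<kappa> * m"
    using moment integrable_id mean prob_space by (simp add: m_def)
  finally show ?thesis .
qed

text \<open>Exponentials are eigenfunctions of convolution: each step multiplies by the truncated
  exponential moment, at most exp(|s|^\<kappa> m). The sign of \<open>s\<close> is free, so the same
  bound serves truncation from above and from below.\<close>

lemma restricted_conv_power_exp_le:
  "(R {y. s * y \<le> 1} ^^ n) (\<lambda>w. ennreal (exp (- s * w))) x
    \<le> ennreal (exp (- s * x) * exp (n * \<bar>s\<bar> powr \<kappa> * m))"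
proof (induction n arbitrary: x)
  case (Suc n)
  let ?A = "{y. s * y \<le> 1}"
  have "(R ?A ^^ Suc n) (\<lambda>w. ennreal (exp (- s * w))) x
    \<le> R ?A (\<lambda>w. ennreal (exp (- s * w) * exp (n * \<bar>s\<bar> powr \<kappa> * m))) x"
    using Suc by (simp add: restricted_conv_mono)
  also have "\<dots> = (\<integral>\<^sup>+y. ennreal (exp (- s * x) * exp (n * \<bar>s\<bar> powr \<kappa> * m))
      * (ennreal (exp (s * y)) * indicator ?A y) \<partial>M)"
    unfolding restricted_conv_def
    by (intro nn_integral_cong)
       (simp add: ennreal_mult'[symmetric] exp_add[symmetric] algebra_simps indicator_def)
  also have "\<dots> = ennreal (exp (- s * x) * exp (n * \<bar>s\<bar> powr \<kappa> * m))
      * (\<integral>\<^sup>+y\<in>?A. ennreal (exp (s * y)) \<partial>M)"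
    by (rule nn_integral_cmult) simp
  also have "\<dots> \<le> ennreal (exp (- s * x) * exp (n * \<bar>s\<bar> powr \<kappa> * m)) * ennreal (exp (\<bar>s\<bar> powr \<kappa> * m))"
    using exp_ge_add_one_self[of "\<bar>s\<bar> powr \<kappa> * m"]
    by (intro mult_left_mono order_trans[OF truncated_exp_moment] ennreal_leI) auto
  also have "\<dots> = ennreal (exp (- s * x) * exp (Suc n * \<bar>s\<bar> powr \<kappa> * m))"
    by (simp add: ennreal_mult'[symmetric] exp_add[symmetric] algebra_simps)
  finally show ?case .
qed simp

text \<open>Markov's inequality for the \<kappa>-th moment restricted to the tail; that restricted
  moment tends to 0 by dominated convergence. The gain from O to o makes n P(|xi| > h) vanish at
  h^\<kappa> = n.\<close>

lemma tail_prob_le: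
  assumes "0 < \<eta>"
  shows "\<forall>\<^sub>F h in at_top. prob {y. h < \<bar>y\<bar>} \<le> \<eta> * h powr - \<kappa>"
proof -
  have "((\<lambda>h. \<integral>y. indicator {y. h < \<bar>y\<bar>} y * \<bar>y\<bar> powr \<kappa> \<partial>M) \<longlongrightarrow> (\<integral>y. 0 \<partial>M)) at_top"
  proof (rule integral_dominated_convergence_at_top[where w = "\<lambda>y. \<bar>y\<bar> powr \<kappa>"])
    show "AE y in M. ((\<lambda>h. indicator {y. h < \<bar>y\<bar>} y * \<bar>y\<bar> powr \<kappa>) \<longlongrightarrow> (0::real)) at_top"
    proof (intro AE_I2 tendsto_eventually)
      fix y :: real
      show "\<forall>\<^sub>F h in at_top. indicator {y. h < \<bar>y\<bar>} y * \<bar>y\<bar> powr \<kappa> = (0::real)"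
        using eventually_ge_at_top[of "\<bar>y\<bar>"] by eventually_elim (auto simp: indicator_def)
    qed
  qed (use moment in \<open>auto simp: indicator_def\<close>)
  then have "\<forall>\<^sub>F h in at_top. (\<integral>y. indicator {y. h < \<bar>y\<bar>} y * \<bar>y\<bar> powr \<kappa> \<partial>M) < \<eta>"
    using assms by (auto dest: order_tendstoD(2))
  then show ?thesis
    using eventually_gt_at_top[of 0]
  proof eventually_elim
    case (elim h)
    have "h powr \<kappa> * prob {y. h < \<bar>y\<bar>} = (\<integral>y. indicator {y. h < \<bar>y\<bar>} y * h powr \<kappa> \<partial>M)"
      by simp
    also have "\<dots> \<le> (\<integral>y. indicator {y. h < \<bar>y\<bar>} y * \<bar>y\<bar> powr \<kappa> \<partial>M)"
    proof (rule integral_mono)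
      show "integrable M (\<lambda>y. indicator {y. h < \<bar>y\<bar>} y * \<bar>y\<bar> powr \<kappa>)"
        by (rule Bochner_Integration.integrable_bound[OF moment]) (auto simp: indicator_def)
    next
      show "integrable M (\<lambda>y. indicator {y. h < \<bar>y\<bar>} y * h powr \<kappa>)"
        by (rule integrable_const_bound[where B = "h powr \<kappa>"]) (auto simp: indicator_def)
    qed (use elim kappa in \<open>auto simp: indicator_def intro: powr_mono2\<close>)
    finally show ?case
      using elim by (simp add: powr_minus divide_simps mult.commute)
  qed
qed

end

subsection \<open>Insensitivity of the local probabilities\<close>

lemma exp_minus_mult_le_iff:
  fixes a b x :: real
  shows "exp (- x) * a \<le> b \<longleftrightarrow> a \<le> exp x * b"
  by (simp add: exp_minus field_simps)

locale big_jump_distribution = centered_distribution +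
  fixes T :: ereal
  assumes T_pos: "0 < T"
    and almost_dec: "almost_decreasing (local_prob M T)"
    and insensitive: "((\<lambda>x. SUP t\<in>{0..x powr (1 / \<kappa>)}.
          ereal \<bar>local_prob M T (x - t) / local_prob M T x - 1\<bar>) \<longlongrightarrow> 0) at_top"
begin

abbreviation p :: "real \<Rightarrow> real" where "p \<equiv> local_prob M T"

lemma p_nonneg [simp]: "0 \<le> p x" and p_le_1 [simp]: "p x \<le> 1"
  by (auto simp: local_prob_def)

lemma sets_Delta [measurable]: "Delta T \<in> sets borel"
  unfolding Delta_def by measurable

lemma shifted_Delta_eq: "shifted_Delta T x = {y. y - x \<in> Delta T}"
  by (force simp: shifted_Delta_def image_iff)

lemma sets_shifted_Delta [measurable]: "shifted_Delta T x \<in> sets borel"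
  unfolding shifted_Delta_eq by measurable

text \<open>Two-sided exponential factors replace the supremum of relative errors because they
  multiply cleanly when shifts are chained.\<close>

lemma p_insensitive:
  assumes "0 < \<epsilon>"
  obtains x0 where "1 \<le> x0" "\<And>w. x0 \<le> w \<Longrightarrow> 0 < p w"
    "\<And>w t. x0 \<le> w \<Longrightarrow> 0 \<le> t \<Longrightarrow> t \<le> w powr (1 / \<kappa>) \<Longrightarrow>
      exp (- \<epsilon>) * p w \<le> p (w - t) \<and> p (w - t) \<le> exp \<epsilon> * p w"
proof -
  \<comment> \<open>Then 1 - \<delta> is exactly exp(-\<epsilon>), and 1 + \<delta> \<le> exp
    \<epsilon> because exp \<epsilon> + exp(-\<epsilon>) \<ge> 2.\<close>
  define \<delta> where "\<delta> = 1 - exp (- \<epsilon>)"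
  have d: "0 < \<delta>" "\<delta> < 1" "1 + \<delta> \<le> exp \<epsilon>"
    using assms exp_ge_add_one_self[of \<epsilon>] exp_ge_add_one_self[of "- \<epsilon>"]
    unfolding \<delta>_def by (auto simp del: exp_ge_add_one_self)
  have "\<forall>\<^sub>F x in at_top. (SUP t\<in>{0..x powr (1 / \<kappa>)}. ereal \<bar>p (x - t) / p x - 1\<bar>) < ereal \<delta>"
    using insensitive by (rule order_tendstoD(2)) (use d in auto)
  then obtain x1 where x1: "\<And>x. x1 \<le> x \<Longrightarrow>
      (SUP t\<in>{0..x powr (1 / \<kappa>)}. ereal \<bar>p (x - t) / p x - 1\<bar>) < ereal \<delta>"
    by (auto simp: eventually_at_top_linorder)
  have bd: "\<bar>p (w - t) / p w - 1\<bar> < \<delta>" if "x1 \<le> w" "0 \<le> t" "t \<le> w powr (1 / \<kappa>)" for w t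
  proof -
    have "ereal \<bar>p (w - t) / p w - 1\<bar> \<le> (SUP t\<in>{0..w powr (1 / \<kappa>)}. ereal \<bar>p (w - t) / p w - 1\<bar>)"
      using that by (intro SUP_upper) auto
    also have "\<dots> < ereal \<delta>" using x1 that by simp
    finally show ?thesis by simp
  qed
  have pos: "0 < p w" if "x1 \<le> w" for w
  proof -
    \<comment> \<open>If \<open>p w\<close> were 0, the quotient at t = 0 would be 0 by convention,
      and its distance 1 from 1 would exceed \<delta>.\<close>
    have "p w \<noteq> 0" using bd[of w 0] that d by auto
    then show ?thesis using p_nonneg[of w] by linarith
  qed
  show thesis
  proof (rule that[of "max 1 x1"])
    fix w t assume w: "max 1 x1 \<le> w" "0 \<le> t" "t \<le> w powr (1 / \<kappa>)"
    have *: "1 - \<delta> \<le> p (w - t) / p w" "p (w - t) / p w \<le> 1 + \<delta>"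
      using bd[of w t] w by auto
    have "exp (- \<epsilon>) * p w \<le> p (w - t)"
      using *(1) pos[of w] w by (simp add: \<delta>_def le_divide_eq)
    moreover have "p (w - t) \<le> exp \<epsilon> * p w"
      using order_trans[OF *(2) d(3)] pos[of w] w by (simp add: divide_le_eq)
    ultimately show "exp (- \<epsilon>) * p w \<le> p (w - t) \<and> p (w - t) \<le> exp \<epsilon> * p w" by simp
  qed (use pos in auto)
qed

lemma p_almost_decreasing:
  obtains C x0 where "1 \<le> C" "1 \<le> x0" "\<And>u v. x0 \<le> u \<Longrightarrow> u \<le> v \<Longrightarrow> p v \<le> C * p u"
proof -
  obtain x1 where x1: "1 \<le> x1" "\<And>w. x1 \<le> w \<Longrightarrow> 0 < p w"
    using p_insensitive[OF zero_less_one] by metis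
  have "(\<lambda>x. SUP y\<in>{x..}. p y) \<in> O[at_top](p)"
    using almost_dec by (simp add: almost_decreasing_def bigtheta_def bigomega_iff_bigo)
  then obtain c where "0 < c" and "\<forall>\<^sub>F x in at_top. norm (SUP y\<in>{x..}. p y) \<le> c * norm (p x)"
    by (auto elim: landau_o.bigE)
  then obtain x2 where x2: "\<And>x. x2 \<le> x \<Longrightarrow> norm (SUP y\<in>{x..}. p y) \<le> c * norm (p x)"
    by (auto simp: eventually_at_top_linorder)
  show thesis
  proof (rule that[of "max c 1" "max x1 x2"])
    fix u v assume uv: "max x1 x2 \<le> u" "u \<le> v"
    have "bdd_above (p ` {u..})" by (rule bdd_aboveI[of _ 1]) auto
    then have "p v \<le> (SUP y\<in>{u..}. p y)" using uv by (intro cSUP_upper) auto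
    also have "\<dots> \<le> c * p u" using x2[of u] uv by simp
    also have "\<dots> \<le> max c 1 * p u" by (intro mult_right_mono) auto
    finally show "p v \<le> max c 1 * p u" .
  qed (use x1 in auto)
qed

text \<open>Descend from \<open>v\<close> to \<open>u\<close> in steps of length u^(1/\<kappa>).
  This length is admissible at every point above \<open>u\<close>, and each step costs a factor exp
  \<epsilon>; the summand 1 accounts for rounding the number of steps up.\<close>

lemma p_ratio_bound:
  assumes "0 < \<epsilon>"
  obtains x0 where "1 \<le> x0" "\<And>w. x0 \<le> w \<Longrightarrow> 0 < p w"
    "\<And>u v. x0 \<le> u \<Longrightarrow> u \<le> v \<Longrightarrow>
      p u \<le> exp (\<epsilon> * (1 + (v - u) / u powr (1 / \<kappa>))) * p v \<and>
      p v \<le> exp (\<epsilon> * (1 + (v - u) / u powr (1 / \<kappa>))) * p u"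
proof -
  obtain x0 where x0: "1 \<le> x0" "\<And>w. x0 \<le> w \<Longrightarrow> 0 < p w"
    "\<And>w t. x0 \<le> w \<Longrightarrow> 0 \<le> t \<Longrightarrow> t \<le> w powr (1 / \<kappa>) \<Longrightarrow>
      exp (- \<epsilon>) * p w \<le> p (w - t) \<and> p (w - t) \<le> exp \<epsilon> * p w"
    using p_insensitive[OF assms] by metis
  have steps: "p u \<le> exp (\<epsilon> * real N) * p v \<and> p v \<le> exp (\<epsilon> * real N) * p u"
    if u: "x0 \<le> u" and "u \<le> v" "v - u \<le> real N * u powr (1 / \<kappa>)" for u v N
    using that(2,3)
  proof (induction N arbitrary: v)
    case (Suc N)
    define s where "s = u powr (1 / \<kappa>)"
    \<comment> \<open>The minimum shortens the last step so that the descent never passes below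
      \<open>u\<close>.\<close>
    define t where "t = min s (v - u)"
    have s: "0 < s" using u x0(1) by (simp add: s_def)
    have "s \<le> v powr (1 / \<kappa>)"
      unfolding s_def using u x0(1) Suc.prems(1) kappa by (intro powr_mono2) auto
    then have t: "0 \<le> t" "t \<le> v powr (1 / \<kappa>)" using s Suc.prems by (auto simp: t_def)
    have step: "exp (- \<epsilon>) * p v \<le> p (v - t)" "p (v - t) \<le> exp \<epsilon> * p v"
      using x0(3)[of v t] t u Suc.prems(1) by auto
    have IH: "p u \<le> exp (\<epsilon> * real N) * p (v - t)" "p (v - t) \<le> exp (\<epsilon> * real N) * p u"
      using Suc.IH[of "v - t"] Suc.prems s
      by (auto simp: t_def s_def[symmetric] min_def algebra_simps split: if_splits)
    have "p u \<le> exp (\<epsilon> * real N) * (exp \<epsilon> * p v)"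
      using IH(1) step(2) by (meson exp_ge_zero mult_left_mono order_trans)
    moreover have "p v \<le> exp \<epsilon> * p (v - t)"
      using step(1) by (simp only: exp_minus_mult_le_iff)
    then have "p v \<le> exp \<epsilon> * (exp (\<epsilon> * real N) * p u)"
      using IH(2) by (meson exp_ge_zero mult_left_mono order_trans)
    ultimately show ?case by (simp add: exp_add algebra_simps)
  qed simp
  show thesis
  proof (rule that[OF x0(1,2)])
    fix u v assume uv: "x0 \<le> u" "u \<le> v"
    define N where "N = nat \<lceil>(v - u) / u powr (1 / \<kappa>)\<rceil>"
    have s: "0 < u powr (1 / \<kappa>)" using uv x0(1) by simp
    have q: "0 \<le> (v - u) / u powr (1 / \<kappa>)" using uv s by simp
    have N: "(v - u) / u powr (1 / \<kappa>) \<le> real N" "real N \<le> 1 + (v - u) / u powr (1 / \<kappa>)"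
      unfolding N_def using q by linarith+
    have "exp (\<epsilon> * real N) \<le> exp (\<epsilon> * (1 + (v - u) / u powr (1 / \<kappa>)))"
      using N assms by simp
    then have "exp (\<epsilon> * real N) * p w \<le> exp (\<epsilon> * (1 + (v - u) / u powr (1 / \<kappa>))) * p w" for w
      by (intro mult_right_mono) auto
    moreover have "v - u \<le> real N * u powr (1 / \<kappa>)" using N(1) s by (simp add: divide_le_eq)
    ultimately show "p u \<le> exp (\<epsilon> * (1 + (v - u) / u powr (1 / \<kappa>))) * p v \<and>
        p v \<le> exp (\<epsilon> * (1 + (v - u) / u powr (1 / \<kappa>))) * p u"
      using steps[OF uv, of N] by (meson order_trans)
  qed auto
qed

text \<open>Induction over dyadic blocks. Going from v/2 to v takes about (v/2)^\<beta> admissible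
  shifts with \<beta> = 1 - 1/\<kappa>, so the total cost is a geometric sum of order v^\<beta>,
  with a constant that can be made as small as desired.\<close>

lemma p_lower_bound:
  assumes "0 < \<theta>"
  obtains c x0 where "0 < c" "1 \<le> x0"
    "\<And>v. x0 \<le> v \<Longrightarrow> c * exp (- \<theta> * v powr (1 - 1 / \<kappa>)) \<le> p v"
proof -
  define \<beta> where "\<beta> = 1 - 1 / \<kappa>"
  have \<beta>: "0 < \<beta>" using kappa by (simp add: \<beta>_def)
  \<comment> \<open>Solves 2\<epsilon> (v/2)^\<beta> + \<theta> (v/2)^\<beta> = \<theta> v^\<beta>,
    so the induction step closes with no loss in \<theta>. The factor 2 covers the rounding summand,
    since (v/2)^\<beta> \<ge> 1.\<close>
  define \<epsilon> where "\<epsilon> = \<theta> * (2 powr \<beta> - 1) / 2"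
  have "1 < 2 powr \<beta>" using \<beta> by simp
  then have \<epsilon>: "0 < \<epsilon>" using assms by (simp add: \<epsilon>_def)
  obtain x0 where x0: "1 \<le> x0" "\<And>w. x0 \<le> w \<Longrightarrow> 0 < p w"
    "\<And>u v. x0 \<le> u \<Longrightarrow> u \<le> v \<Longrightarrow>
      p u \<le> exp (\<epsilon> * (1 + (v - u) / u powr (1 / \<kappa>))) * p v"
    using p_ratio_bound[OF \<epsilon>] by metis
  \<comment> \<open>The loss on the initial block from \<open>x0\<close> to 2 \<open>x0\<close>,
    where shifts have length at least 1.\<close>
  define c where "c = exp (- \<epsilon> * (1 + x0)) * p x0"
  have c: "0 < c" using x0 by (simp add: c_def)
  have "c * exp (- \<theta> * v powr \<beta>) \<le> p v" if "x0 \<le> v" "v \<le> 2 ^ Suc N * x0" for v N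
    using that
  proof (induction N arbitrary: v)
    case 0
    have "1 \<le> x0 powr (1 / \<kappa>)" using x0(1) kappa by (simp add: ge_one_powr_ge_zero)
    then have "(v - x0) / x0 powr (1 / \<kappa>) \<le> (v - x0) / 1"
      using 0 by (intro divide_left_mono) auto
    then have "exp (\<epsilon> * (1 + (v - x0) / x0 powr (1 / \<kappa>))) \<le> exp (\<epsilon> * (1 + x0))"
      using 0 \<epsilon> by simp
    then have "p x0 \<le> exp (\<epsilon> * (1 + x0)) * p v"
      using 0 by (intro order_trans[OF x0(3)[of x0 v] mult_right_mono]) auto
    then have "c \<le> p v"
      unfolding c_def mult_minus_left exp_minus_mult_le_iff .
    moreover have "c * exp (- \<theta> * v powr \<beta>) \<le> c * 1"
      using c assms by (intro mult_left_mono) auto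
    ultimately show ?case by simp
  next
    case (Suc N)
    show ?case
    proof (cases "v \<le> 2 ^ Suc N * x0")
      case True
      then show ?thesis using Suc by simp
    next
      case False
      moreover have "2 * x0 \<le> 2 ^ Suc N * x0" using x0(1) by simp
      ultimately have v: "x0 \<le> v / 2" by simp
      have IH: "c * exp (- \<theta> * (v / 2) powr \<beta>) \<le> p (v / 2)"
        using Suc v by simp
      have "v / 2 / (v / 2) powr (1 / \<kappa>) = (v / 2) powr \<beta>"
        using v x0(1) by (simp add: \<beta>_def powr_diff)
      moreover have "1 \<le> (v / 2) powr \<beta>" using v x0(1) \<beta> by (simp add: ge_one_powr_ge_zero)
      ultimately have "\<epsilon> * (1 + (v - v / 2) / (v / 2) powr (1 / \<kappa>)) \<le> \<epsilon> * (2 * (v / 2) powr \<beta>)"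
        using \<epsilon> by (intro mult_left_mono) auto
      then have "p (v / 2) \<le> exp (\<epsilon> * (2 * (v / 2) powr \<beta>)) * p v"
        using v x0(1) by (intro order_trans[OF x0(3)[of "v / 2" v] mult_right_mono]) auto
      with IH have "c * exp (- \<theta> * (v / 2) powr \<beta>) \<le> exp (\<epsilon> * (2 * (v / 2) powr \<beta>)) * p v"
        by linarith
      then have "exp (- (\<epsilon> * (2 * (v / 2) powr \<beta>))) * (c * exp (- \<theta> * (v / 2) powr \<beta>)) \<le> p v"
        unfolding exp_minus_mult_le_iff .
      moreover have "exp (- (\<epsilon> * (2 * (v / 2) powr \<beta>))) * (c * exp (- \<theta> * (v / 2) powr \<beta>))
          = c * exp (- (\<epsilon> * (2 * (v / 2) powr \<beta>)) + - \<theta> * (v / 2) powr \<beta>)"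
        by (simp only: exp_add mult_ac)
      moreover have alg: "- (\<theta> * (W - 1) / 2 * (2 * (V / W))) + - \<theta> * (V / W) = - \<theta> * V"
        if "W \<noteq> 0" for V W :: real
        using that by (simp add: field_simps)
      have "- (\<epsilon> * (2 * (v / 2) powr \<beta>)) + - \<theta> * (v / 2) powr \<beta> = - \<theta> * v powr \<beta>"
        unfolding \<epsilon>_def powr_divide by (rule alg) simp
      ultimately show ?thesis by (simp only:)
    qed
  qed
  moreover have "\<exists>N. v \<le> 2 ^ Suc N * x0" if "x0 \<le> v" for v
  proof -
    obtain N where "v < 2 ^ N" using real_arch_pow[of 2 v] by auto
    moreover have "(2::real) ^ N * 1 \<le> 2 ^ N * (2 * x0)"
      using x0(1) by (intro mult_left_mono) auto
    ultimately have "v \<le> 2 ^ Suc N * x0" by (simp only: power_Suc mult_ac mult_1_right)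
    then show ?thesis ..
  qed
  ultimately have "c * exp (- \<theta> * v powr (1 - 1 / \<kappa>)) \<le> p v" if "x0 \<le> v" for v
    using that unfolding \<beta>_def by meson
  then show thesis by (rule that[OF c x0(1)])
qed

end

subsection \<open>Two large jumps\<close>

context big_jump_distribution
begin

text \<open>The indicator is reflected so that evaluating it at x - y tests whether y lies in x +
  Delta. An operator power applied to it at x is then the mass that the convolution power gives to x
  + Delta.\<close>

definition target :: "real \<Rightarrow> ennreal" where
  "target = indicator {w. - w \<in> Delta T}"

lemma target_measurable [measurable]: "target \<in> borel_measurable borel"
  unfolding target_def by measurable

lemma target_diff: "target (x - y) = indicator (shifted_Delta T x) y"
  by (simp add: target_def shifted_Delta_eq indicator_def)

lemma emeasure_shifted_Delta: "emeasure M (shifted_Delta T x) = ennreal (p x)"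
  by (simp add: local_prob_def emeasure_eq_measure)

lemma restricted_conv_target:
  assumes "A \<in> sets borel"
  shows "R A target x = emeasure M (A \<inter> shifted_Delta T x)"
  unfolding restricted_conv_def target_diff
  using assms by (simp add: indicator_inter_arith[symmetric] Int_commute)

lemma restricted_conv_target_le:
  assumes "A \<in> sets borel"
  shows "R A target x \<le> ennreal (p x)"
  unfolding restricted_conv_target[OF assms] emeasure_shifted_Delta[symmetric]
  by (rule emeasure_mono) auto

lemma restricted_conv_target_eq:
  assumes "h \<le> x"
  shows "R {h<..} target x = ennreal (p x)"
proof -
  have "{h<..} \<inter> shifted_Delta T x = shifted_Delta T x"
    using assms by (auto simp: shifted_Delta_eq Delta_def)
  then show ?thesis by (simp add: restricted_conv_target emeasure_shifted_Delta)
qed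

text \<open>Here x enters through the set x + Delta; writing \<open>p\<close> as a convolution of
  \<open>target\<close> turns it into a parameter of an integral.\<close>

lemma p_measurable [measurable]: "p \<in> borel_measurable borel"
proof -
  have "(\<lambda>x. enn2real (R UNIV target x)) \<in> borel_measurable borel" by measurable
  moreover have "enn2real (R UNIV target x) = p x" for x
    by (simp add: restricted_conv_target emeasure_shifted_Delta)
  ultimately show ?thesis by simp
qed

lemma p_le_tail:
  assumes "0 \<le> h" "h \<le> x"
  shows "p x \<le> prob {y. h < \<bar>y\<bar>}"
  unfolding local_prob_def
  using assms by (intro finite_measure_mono) (auto simp: shifted_Delta_eq Delta_def)

text \<open>If \<open>y + y' \<in> x + \<Delta>\<close>, then \<open>y \<le> x/2\<close>, or \<open>y' \<le> x/2\<close>, or both lie in \<open>x/2 + \<Delta>\<close>.\<close>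

lemma two_jumps_le:
  "R {h<..} (R {h<..} target) x
    \<le> 2 * (\<integral>\<^sup>+y\<in>{h<..x / 2}. ennreal (p (x - y)) \<partial>M) + ennreal (p (x / 2) * p (x / 2))"
proof -
  interpret P: pair_sigma_finite M M ..
  let ?B = "{h<..x / 2}" and ?C = "shifted_Delta T (x / 2)"
  have pw: "indicator (shifted_Delta T (x - y)) y' * indicator {h<..} y' * indicator {h<..} y
      \<le> indicator (shifted_Delta T (x - y)) y' * indicator ?B y
        + indicator (shifted_Delta T (x - y')) y * indicator ?B y'
        + indicator ?C y' * (indicator ?C y :: ennreal)" for y y'
  proof (cases "y + y' - x \<in> Delta T \<and> h < y \<and> h < y' \<and> x / 2 < y \<and> x / 2 < y'")
    case True
    then have "0 < y - x / 2" "0 < y' - x / 2" "ereal (y + y' - x) \<le> T"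
      by (auto simp: Delta_def)
    \<comment> \<open>Both excesses over x/2 are positive and their sum is y + y' - x, so each of
      them inherits the bound by T.\<close>
    moreover from this have "ereal (y - x / 2) \<le> T" "ereal (y' - x / 2) \<le> T"
      by (auto elim!: order_trans[rotated])
    ultimately have "y \<in> ?C" "y' \<in> ?C"
      by (auto simp: shifted_Delta_eq Delta_def)
    then show ?thesis by (auto simp: indicator_def add_increasing)
  qed (auto simp: indicator_def shifted_Delta_eq algebra_simps not_less)
  have "R {h<..} (R {h<..} target) x
      = (\<integral>\<^sup>+y. \<integral>\<^sup>+y'. indicator (shifted_Delta T (x - y)) y' * indicator {h<..} y' * indicator {h<..} y \<partial>M \<partial>M)"
    unfolding restricted_conv_def target_diff by (simp add: nn_integral_multc)
  also have "\<dots> \<le> (\<integral>\<^sup>+y. \<integral>\<^sup>+y'. indicator (shifted_Delta T (x - y)) y' * indicator ?B y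
        + indicator (shifted_Delta T (x - y')) y * indicator ?B y'
        + indicator ?C y' * indicator ?C y \<partial>M \<partial>M)"
    by (intro nn_integral_mono pw)
  also have "\<dots> = (\<integral>\<^sup>+y. \<integral>\<^sup>+y'. indicator (shifted_Delta T (x - y)) y' * indicator ?B y \<partial>M \<partial>M)
        + (\<integral>\<^sup>+y. \<integral>\<^sup>+y'. indicator (shifted_Delta T (x - y')) y * indicator ?B y' \<partial>M \<partial>M)
        + (\<integral>\<^sup>+y. \<integral>\<^sup>+y'. indicator ?C y' * indicator ?C y \<partial>M \<partial>M)"
    unfolding shifted_Delta_eq by (simp add: nn_integral_add)
  \<comment> \<open>Exchanging the roles of the two jumps identifies the second summand with the
    first; this is the factor 2.\<close>
  also have "(\<integral>\<^sup>+y. \<integral>\<^sup>+y'. indicator (shifted_Delta T (x - y')) y * indicator ?B y' \<partial>M \<partial>M)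
      = (\<integral>\<^sup>+y'. \<integral>\<^sup>+y. indicator (shifted_Delta T (x - y')) y * indicator ?B y' \<partial>M \<partial>M)"
    unfolding shifted_Delta_eq by (rule P.Fubini') measurable
  also have "(\<integral>\<^sup>+y. \<integral>\<^sup>+y'. indicator (shifted_Delta T (x - y)) y' * indicator ?B y \<partial>M \<partial>M)
      = (\<integral>\<^sup>+y\<in>?B. ennreal (p (x - y)) \<partial>M)"
    by (simp add: nn_integral_multc emeasure_shifted_Delta)
  also have "(\<integral>\<^sup>+y. \<integral>\<^sup>+y'. indicator ?C y' * indicator ?C y \<partial>M \<partial>M) = ennreal (p (x / 2) * p (x / 2))"
    by (simp add: nn_integral_multc nn_integral_cmult emeasure_shifted_Delta ennreal_mult)
  finally show ?thesis by (simp add: mult_2)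
qed

text \<open>Convolving with further steps evaluates both sides at arbitrary points, so the estimate
  is carried below h. With T infinite both sides are constant there and equal their values at h.
  With T \<le> h the left side vanishes: two jumps exceed 2h, whereas x + Delta lies below
  2h.\<close>

lemma two_jumps_le_all:
  assumes "0 \<le> h" "T = \<infinity> \<or> T \<le> ereal h"
    and le: "\<And>x. h \<le> x \<Longrightarrow> R {h<..} (R {h<..} target) x \<le> ennreal e * ennreal (p x)"
  shows "R {h<..} (R {h<..} target) x \<le> ennreal e * R {h<..} target x"
proof (cases "h \<le> x")
  case True
  then show ?thesis using le restricted_conv_target_eq by simp
next
  case False
  show ?thesis
  proof (cases "T = \<infinity>")
    case True
    \<comment> \<open>For w \<le> h the half-line beyond w contains every jump larger than h, which
      makes \<open>R {h<..} target\<close> constant there.\<close>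
    have "{h<..} \<inter> shifted_Delta T w = {h<..}" if "w \<le> h" for w
      unfolding shifted_Delta_eq Delta_def using that True by auto
    then have *: "R {h<..} target w = R {h<..} target h" if "w \<le> h" for w
      using that by (simp add: restricted_conv_target)
    have "R {h<..} (R {h<..} target) x = R {h<..} (R {h<..} target) h"
      unfolding restricted_conv_def[of _ _ "R {h<..} target"]
    proof (intro nn_integral_cong)
      fix y
      show "R {h<..} target (x - y) * indicator {h<..} y = R {h<..} target (h - y) * indicator {h<..} y"
        using *[of "x - y"] *[of "h - y"] False assms(1) by (cases "h < y") auto
    qed
    also have "\<dots> \<le> ennreal e * ennreal (p h)" by (rule le) simp
    also have "\<dots> = ennreal e * R {h<..} target x"
      using *[of x] False restricted_conv_target_eq[of h h] by simp
    finally show ?thesis .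
  next
    case finite: False
    then have T: "T \<le> ereal h" using assms by simp
    have "R {h<..} target (x - y) * indicator {h<..} y = 0" for y
    proof (cases "h < y")
      case True
      have "y' \<notin> shifted_Delta T (x - y)" if "h < y'" for y'
      proof
        assume "y' \<in> shifted_Delta T (x - y)"
        then have "ereal (y' - (x - y)) \<le> T"
          by (auto simp: shifted_Delta_eq Delta_def)
        then have "ereal (y' - (x - y)) \<le> ereal h"
          using T by (rule order_trans)
        then show False using that True False by simp
      qed
      then have "{h<..} \<inter> shifted_Delta T (x - y) = {}" by auto
      then show ?thesis by (simp add: restricted_conv_target)
    qed simp
    then have "R {h<..} (R {h<..} target) x = 0"
      unfolding restricted_conv_def[of _ _ "R {h<..} target"]
      by (simp only: nn_integral_const mult_zero_left)
    then show ?thesis by simp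
  qed
qed

text \<open>Regular variation at the single ratio 2, with almost monotonicity, bounds p(x - y) by a
  multiple of p(x) for all y \<le> x/2. The other jump then contributes P(|xi| > h) =
  o(h^-\<kappa>).\<close>

lemma two_jumps_regularly_varying:
  assumes ORV: "O_regularly_varying (\<lambda>x. x powr \<kappa> * p x)" and "0 < \<eta>"
  shows "\<forall>\<^sub>F h in at_top. \<forall>x\<ge>h. R {h<..} (R {h<..} target) x \<le> ennreal (\<eta> * h powr - \<kappa>) * ennreal (p x)"
proof -
  obtain C x0 where C: "1 \<le> C" "1 \<le> x0" "\<And>u v. x0 \<le> u \<Longrightarrow> u \<le> v \<Longrightarrow> p v \<le> C * p u"
    using p_almost_decreasing by metis
  have "0 < Liminf at_top (\<lambda>x. ereal (((x * 2) powr \<kappa> * p (x * 2)) / (x powr \<kappa> * p x)))"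
    using ORV by (simp add: O_regularly_varying_def)
  then obtain d where d: "0 < d"
    "d < Liminf at_top (\<lambda>x. ereal (((x * 2) powr \<kappa> * p (x * 2)) / (x powr \<kappa> * p x)))"
    using dense by blast
  then have "d \<noteq> \<infinity>" "d \<noteq> - \<infinity>" by auto
  then obtain c where c: "d = ereal c" by (cases d) auto
  have "\<forall>\<^sub>F x in at_top. ereal c < ereal (((x * 2) powr \<kappa> * p (x * 2)) / (x powr \<kappa> * p x))"
    using less_LiminfD[OF d(2)] c by simp
  then obtain x1 where x1: "\<And>x. x1 \<le> x \<Longrightarrow> c < ((x * 2) powr \<kappa> * p (x * 2)) / (x powr \<kappa> * p x)"
    by (auto simp: eventually_at_top_linorder)
  \<comment> \<open>The lower limit \<open>c\<close> concerns x^\<kappa> p(x); removing the power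
    weight contributes 2^\<kappa>.\<close>
  define D where "D = 2 powr \<kappa> / c"
  have c0: "0 < c" using d c by simp
  have D: "0 < D" using c0 by (simp add: D_def)
  have half: "p (x / 2) \<le> D * p x" if "2 * x1 \<le> x" "0 < x" for x
  proof (cases "p (x / 2) = 0")
    case False
    have "c < (x powr \<kappa> * p x) / ((x / 2) powr \<kappa> * p (x / 2))"
      using x1[of "x / 2"] that by simp
    also have "\<dots> = 2 powr \<kappa> * p x / p (x / 2)"
      using that by (simp add: powr_divide)
    finally show ?thesis
      using False p_nonneg[of "x / 2"] c0 by (simp add: D_def field_simps)
  qed (use D in auto)
  \<comment> \<open>The denominator collects 2CD from the two symmetric integrals and D 2^\<kappa>
    from the square, whose tail is taken at h/2.\<close>
  define \<eta>' where "\<eta>' = \<eta> / (2 * C * D + D * 2 powr \<kappa>)"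
  have den: "0 < 2 * C * D + D * 2 powr \<kappa>" using C D by (simp add: add_pos_pos)
  have \<eta>': "0 < \<eta>'" using den assms by (simp add: \<eta>'_def)
  have ev: "\<forall>\<^sub>F h in at_top. prob {y. h < \<bar>y\<bar>} \<le> \<eta>' * h powr - \<kappa>"
    by (rule tail_prob_le[OF \<eta>'])
  moreover have "\<forall>\<^sub>F h in at_top. prob {y. h / 2 < \<bar>y\<bar>} \<le> \<eta>' * (h / 2) powr - \<kappa>"
  proof -
    have "filterlim (\<lambda>h::real. h / 2) at_top at_top"
      by (rule filterlim_at_top_mult_tendsto_pos[of "\<lambda>_. 1/2" "1/2" _ "\<lambda>x. x", simplified])
         (auto simp: filterlim_ident)
    then show ?thesis using ev unfolding filterlim_iff by blast
  qed
  ultimately show ?thesis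
    using eventually_ge_at_top[of "max 1 (max (2 * x1) (2 * x0))"]
  proof eventually_elim
    case (elim h)
    show ?case
    proof (intro allI impI)
      fix x assume x: "h \<le> x"
      have px: "p (x / 2) \<le> D * p x" using half x elim by simp
      have "(\<integral>\<^sup>+y\<in>{h<..x / 2}. ennreal (p (x - y)) \<partial>M)
          \<le> (\<integral>\<^sup>+y. ennreal (C * D * p x) * indicator {y. h < \<bar>y\<bar>} y \<partial>M)"
      proof (intro nn_integral_mono)
        fix y
        have "p (x - y) \<le> C * D * p x" if "y \<le> x / 2"
        proof -
          have "p (x - y) \<le> C * p (x / 2)" using that x elim by (intro C(3)) auto
          also have "\<dots> \<le> C * (D * p x)" using px C by (intro mult_left_mono) auto
          finally show ?thesis by simp
        qed
        then show "ennreal (p (x - y)) * indicator {h<..x / 2} y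
            \<le> ennreal (C * D * p x) * indicator {y. h < \<bar>y\<bar>} y"
          by (auto simp: indicator_def intro: ennreal_leI)
      qed
      also have "\<dots> = ennreal (C * D * p x) * emeasure M {y. h < \<bar>y\<bar>}"
        by (subst nn_integral_cmult_indicator) auto
      also have "\<dots> \<le> ennreal (C * D * p x * (\<eta>' * h powr - \<kappa>))"
        using elim(1) C D by (simp add: emeasure_eq_measure ennreal_mult'[symmetric] ennreal_leI mult_left_mono)
      finally have 1: "(\<integral>\<^sup>+y\<in>{h<..x / 2}. ennreal (p (x - y)) \<partial>M) \<le> ennreal (C * D * p x * (\<eta>' * h powr - \<kappa>))" .
      \<comment> \<open>In the product of two equal factors, one is compared with p(x) and the other
        with the tail probability.\<close>
      have "p (x / 2) \<le> \<eta>' * (h / 2) powr - \<kappa>"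
        using p_le_tail[of "h / 2" "x / 2"] elim x by simp
      then have "p (x / 2) * p (x / 2) \<le> (D * p x) * (\<eta>' * (h / 2) powr - \<kappa>)"
        using px D by (intro mult_mono) auto
      also have "(h / 2) powr - \<kappa> = 2 powr \<kappa> * h powr - \<kappa>"
        using elim by (simp add: powr_divide powr_minus field_simps)
      finally have 2: "p (x / 2) * p (x / 2) \<le> D * p x * (\<eta>' * (2 powr \<kappa> * h powr - \<kappa>))" .
      have "R {h<..} (R {h<..} target) x \<le>
          2 * ennreal (C * D * p x * (\<eta>' * h powr - \<kappa>)) + ennreal (D * p x * (\<eta>' * (2 powr \<kappa> * h powr - \<kappa>)))"
        by (intro order_trans[OF two_jumps_le] add_mono mult_left_mono 1 ennreal_leI 2) auto
      also have "\<dots> = ennreal (2 * (C * D * p x * (\<eta>' * h powr - \<kappa>)) + D * p x * (\<eta>' * (2 powr \<kappa> * h powr - \<kappa>)))"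
        using C D \<eta>' by (simp add: ennreal_plus ennreal_mult'')
      also have "2 * (C * D * p x * (\<eta>' * h powr - \<kappa>)) + D * p x * (\<eta>' * (2 powr \<kappa> * h powr - \<kappa>))
          = (\<eta>' * (2 * C * D + D * 2 powr \<kappa>)) * h powr - \<kappa> * p x"
        by (simp add: algebra_simps)
      also have "\<eta>' * (2 * C * D + D * 2 powr \<kappa>) = \<eta>" using den by (simp add: \<eta>'_def)
      finally show "R {h<..} (R {h<..} target) x \<le> ennreal (\<eta> * h powr - \<kappa>) * ennreal (p x)"
        using assms by (simp add: ennreal_mult)
    qed
  qed
qed

end

section \<open>Two large jumps when x^\<kappa> F(x+Delta) belongs to Sd\<close>

lemma exp_minus_mult_powr_le:
  fixes B \<epsilon> \<kappa> :: real
  assumes "0 < \<epsilon>"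
  shows "\<forall>\<^sub>F x in at_top. exp (- \<epsilon>) * x powr \<kappa> \<le> (x - B) powr \<kappa>"
proof -
  have "((\<lambda>x::real. B / x) \<longlongrightarrow> 0) at_top"
    by (intro tendsto_divide_0[OF tendsto_const] filterlim_at_top_imp_at_infinity filterlim_ident)
  then have "((\<lambda>x. (1 - B / x) powr \<kappa>) \<longlongrightarrow> (1 - 0) powr \<kappa>) at_top"
    by (intro tendsto_intros) auto
  then have "\<forall>\<^sub>F x in at_top. exp (- \<epsilon>) < (1 - B / x) powr \<kappa>"
    by (rule order_tendstoD(1)) (use assms in simp)
  then show ?thesis
    using eventually_gt_at_top[of "max 0 B"]
  proof eventually_elim
    case (elim x)
    have "exp (- \<epsilon>) * x powr \<kappa> \<le> (1 - B / x) powr \<kappa> * x powr \<kappa>"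
      using elim by (intro mult_right_mono) auto
    also have "\<dots> = ((1 - B / x) * x) powr \<kappa>"
      using elim by (subst powr_mult) (auto simp: divide_simps)
    also have "(1 - B / x) * x = x - B" using elim by (simp add: field_simps)
    finally show ?case .
  qed
qed

context big_jump_distribution
begin

abbreviation H :: "real \<Rightarrow> real" where "H x \<equiv> x powr \<kappa> * p x"

text \<open>On this bounded interval p \<le> 1 bounds both factors by x^\<kappa>. Integrability is
  needed to split the Bochner integral in the definition of \<open>Sd\<close>.\<close>

lemma set_integrable_H_convolution:
  "set_integrable lborel {0..x / 2} (\<lambda>y. H y * H (x - y))"
proof (rule set_integrable_bound)
  show "set_integrable lborel {0..x / 2} (\<lambda>y. x powr \<kappa> * x powr \<kappa>)"
  proof -
    have "integrable lborel (indicat_real {0..x / 2})"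
      by (intro integrable_real_indicator) (auto simp: emeasure_lborel_Icc_eq)
    then show ?thesis by (simp add: set_integrable_def)
  qed
  show "set_borel_measurable lborel {0..x / 2} (\<lambda>y. H y * H (x - y))"
    unfolding set_borel_measurable_def by measurable
  have "norm (H y * H (x - y)) \<le> norm (x powr \<kappa> * x powr \<kappa>)" if "y \<in> {0..x / 2}" for y
  proof -
    have "y powr \<kappa> * p y \<le> x powr \<kappa> * 1" "(x - y) powr \<kappa> * p (x - y) \<le> x powr \<kappa> * 1"
      using that kappa by (intro mult_mono powr_mono2; simp)+
    then show ?thesis
      using mult_mono[of "H y" "x powr \<kappa>" "H (x - y)" "x powr \<kappa>"] by (simp add: abs_mult)
  qed
  then show "AE y in lborel. y \<in> {0..x / 2} \<longrightarrow> norm (H y * H (x - y)) \<le> norm (x powr \<kappa> * x powr \<kappa>)"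
    by auto
qed

text \<open>The integral over [0, x/2] is asymptotically I H(x), with I the integral of H. The part
  over [0, B] already gives almost that much, because H(x - y) is close to H(x) uniformly in y \<le>
  B. What remains beyond B must be small.\<close>

lemma Sd_truncated_convolution:
  assumes Sd: "Sd H" and "0 < \<delta>"
  obtains B x0 where "0 < B" "\<And>b x. B \<le> b \<Longrightarrow> x0 \<le> x \<Longrightarrow>
    (\<integral>\<^sup>+u\<in>{b..x / 2}. ennreal (H u * H (x - u)) \<partial>lborel) \<le> ennreal (\<delta> * H x)"
proof -
  define I where "I = (LBINT y:{0..}. H y)"
  have int: "set_integrable lborel {0..} H"
    and lim: "((\<lambda>x. (LBINT y:{0..x / 2}. H y * H (x - y)) / H x) \<longlongrightarrow> I) at_top"
    using Sd by (auto simp: Sd_def I_def)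
  have I: "0 \<le> I"
    unfolding I_def set_lebesgue_integral_def by (intro integral_nonneg_AE) (auto simp: indicator_def)
  have "((\<lambda>b. LBINT y:{0..b}. H y) \<longlongrightarrow> I) at_top"
    unfolding I_def by (rule tendsto_set_lebesgue_integral_at_top[OF _ int]) auto
  then have "\<forall>\<^sub>F b in at_top. I - \<delta> / 4 < (LBINT y:{0..b}. H y)"
    using assms by (intro order_tendstoD(1)) auto
  then have "\<forall>\<^sub>F b in at_top. I - \<delta> / 4 < (LBINT y:{0..b}. H y) \<and> 0 < b"
    using eventually_gt_at_top[of 0] by eventually_elim auto
  then obtain B where B: "I - \<delta> / 4 < (LBINT y:{0..B}. H y)" "0 < B"
    unfolding eventually_at_top_linorder by blast
  \<comment> \<open>The factor exp(-2\<epsilon>) then loses at most \<delta>/4, which together with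
    the \<delta>/4 lost by stopping at B makes \<delta>/2.\<close>
  define \<epsilon> where "\<epsilon> = \<delta> / (8 * (I + 1))"
  have \<epsilon>: "0 < \<epsilon>" using assms I by (simp add: \<epsilon>_def)
  obtain x1 where x1: "1 \<le> x1" "\<And>w. x1 \<le> w \<Longrightarrow> 0 < p w"
    "\<And>w t. x1 \<le> w \<Longrightarrow> 0 \<le> t \<Longrightarrow> t \<le> w powr (1 / \<kappa>) \<Longrightarrow> exp (- \<epsilon>) * p w \<le> p (w - t)"
    using p_insensitive[OF \<epsilon>] by metis
  have "filterlim (\<lambda>w::real. w powr (1 / \<kappa>)) at_top at_top"
    using kappa by (intro real_powr_at_top) auto
  then have ev1: "\<forall>\<^sub>F w in at_top. B \<le> w powr (1 / \<kappa>)"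
    by (simp add: filterlim_at_top)
  have "\<forall>\<^sub>F x in at_top. (LBINT y:{0..x / 2}. H y * H (x - y)) / H x < I + \<delta> / 2"
    using lim assms by (intro order_tendstoD(2)) auto
  with ev1 exp_minus_mult_powr_le[OF \<epsilon>, of \<kappa> B] eventually_ge_at_top[of "max x1 (2 * B)"]
  have "\<forall>\<^sub>F x in at_top. \<forall>b\<ge>B.
    (\<integral>\<^sup>+u\<in>{b..x / 2}. ennreal (H u * H (x - u)) \<partial>lborel) \<le> ennreal (\<delta> * H x)"
  proof eventually_elim
    case (elim x)
    have Hx: "0 < H x" using elim x1 by simp
    have lower: "exp (- 2 * \<epsilon>) * H x \<le> H (x - y)" if "y \<in> {0..B}" for y
    proof -
      have "(x - B) powr \<kappa> \<le> (x - y) powr \<kappa>"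
        using that elim B kappa by (intro powr_mono2) auto
      then have "(exp (- \<epsilon>) * x powr \<kappa>) * (exp (- \<epsilon>) * p x) \<le> (x - y) powr \<kappa> * p (x - y)"
        using elim that x1(3)[of x y] by (intro mult_mono) auto
      moreover have "exp (- 2 * \<epsilon>) = exp (- \<epsilon>) * exp (- \<epsilon>)"
        by (simp add: exp_add[symmetric])
      ultimately show ?thesis by (simp add: mult_ac)
    qed
    have intB: "set_integrable lborel {0..B} H"
      by (rule set_integrable_subset[OF int]) auto
    have intx: "set_integrable lborel {0..x / 2} (\<lambda>y. H y * H (x - y))"
      by (rule set_integrable_H_convolution)
    have "(I - \<delta> / 2) * H x \<le> exp (- 2 * \<epsilon>) * H x * (LBINT y:{0..B}. H y)"
    \<comment> \<open>For small I the left side is not positive; otherwise both factors to be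
      multiplied are nonnegative.\<close>
    proof (cases "I \<le> \<delta> / 2")
      case True
      have "0 \<le> (LBINT y:{0..B}. H y)"
        unfolding set_lebesgue_integral_def by (intro integral_nonneg_AE) (auto simp: indicator_def)
      then have "0 \<le> exp (- 2 * \<epsilon>) * H x * (LBINT y:{0..B}. H y)"
        using Hx by (intro mult_nonneg_nonneg) auto
      moreover have "(I - \<delta> / 2) * H x \<le> 0"
        using True Hx by (intro mult_nonpos_nonneg) auto
      ultimately show ?thesis by linarith
    next
      case False
      have "2 * \<epsilon> * (I - \<delta> / 4) \<le> 2 * \<epsilon> * (I + 1)"
        using \<epsilon> assms by (intro mult_left_mono) auto
      also have "\<dots> = \<delta> / 4" using I by (simp add: \<epsilon>_def field_simps)
      finally have "I - \<delta> / 2 \<le> (1 - 2 * \<epsilon>) * (I - \<delta> / 4)"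
        by (simp add: algebra_simps)
      also have "\<dots> \<le> exp (- 2 * \<epsilon>) * (LBINT y:{0..B}. H y)"
        using B False assms exp_ge_add_one_self[of "- 2 * \<epsilon>"] by (intro mult_mono) auto
      finally have "(I - \<delta> / 2) * H x \<le> exp (- 2 * \<epsilon>) * (LBINT y:{0..B}. H y) * H x"
        by (rule mult_right_mono) (use Hx in auto)
      then show ?thesis by (simp only: mult_ac)
    qed
    also have "\<dots> = (LBINT y:{0..B}. H y * (exp (- 2 * \<epsilon>) * H x))"
      by (subst set_integral_mult_left) (rule mult.commute)
    also have "\<dots> \<le> (LBINT y:{0..B}. H y * H (x - y))"
      using lower elim
      by (intro set_integral_mono set_integrable_subset[OF intx] set_integrable_mult_left intB mult_left_mono) auto
    finally have low: "(I - \<delta> / 2) * H x \<le> (LBINT y:{0..B}. H y * H (x - y))" .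
    have intB': "set_integrable lborel {0..B} (\<lambda>y. H y * H (x - y))"
      "set_integrable lborel {B<..x / 2} (\<lambda>y. H y * H (x - y))"
      using elim B by (auto intro!: set_integrable_subset[OF intx])
    have "{0..x / 2} = {0..B} \<union> {B<..x / 2}" using elim B by auto
    then have "(LBINT y:{0..x / 2}. H y * H (x - y))
        = (LBINT y:{0..B}. H y * H (x - y)) + (LBINT y:{B<..x / 2}. H y * H (x - y))"
      using intB' by (simp only:) (rule set_integral_Un; auto)
    moreover have "(LBINT y:{0..x / 2}. H y * H (x - y)) < (I + \<delta> / 2) * H x"
      using elim Hx by (simp add: divide_less_eq)
    ultimately have up: "(LBINT y:{B<..x / 2}. H y * H (x - y)) \<le> \<delta> * H x"
      using low by (simp add: algebra_simps)
    show ?case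
    proof (intro allI impI)
      fix b assume "B \<le> b"
      have "(\<integral>\<^sup>+u\<in>{b..x / 2}. ennreal (H u * H (x - u)) \<partial>lborel)
          \<le> (\<integral>\<^sup>+u\<in>{B..x / 2}. ennreal (H u * H (x - u)) \<partial>lborel)"
        using \<open>B \<le> b\<close> by (intro nn_set_integral_set_mono) auto
      also have "\<dots> = (\<integral>\<^sup>+u. ennreal (indicator {B<..x / 2} u * (H u * H (x - u))) \<partial>lborel)"
      proof (rule nn_integral_cong_AE)
        show "AE u in lborel. ennreal (H u * H (x - u)) * indicator {B..x / 2} u
            = ennreal (indicator {B<..x / 2} u * (H u * H (x - u)))"
          using AE_lborel_singleton[of B]
        proof eventually_elim
          case (elim u)
          then have "u \<in> {B..x / 2} \<longleftrightarrow> u \<in> {B<..x / 2}" by auto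
          then show ?case by (simp only: indicator_def) (simp split: if_split)
        qed
      qed
      also have "\<dots> = ennreal (LBINT y:{B<..x / 2}. H y * H (x - y))"
        unfolding set_lebesgue_integral_def real_scaleR_def
        using intB'(2) by (intro nn_integral_eq_integral) (auto simp: set_integrable_def)
      also have "\<dots> \<le> ennreal (\<delta> * H x)" by (rule ennreal_leI[OF up])
      finally show "(\<integral>\<^sup>+u\<in>{b..x / 2}. ennreal (H u * H (x - u)) \<partial>lborel) \<le> ennreal (\<delta> * H x)" .
    qed
  qed
  then obtain x0 where "\<And>x b. x0 \<le> x \<Longrightarrow> B \<le> b \<Longrightarrow>
    (\<integral>\<^sup>+u\<in>{b..x / 2}. ennreal (H u * H (x - u)) \<partial>lborel) \<le> ennreal (\<delta> * H x)"
    unfolding eventually_at_top_linorder by meson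
  then show thesis by (intro that[OF B(2)]) auto
qed

lemma p_window:
  assumes "ereal t \<le> T"
  shows "emeasure M {u<..u + t} \<le> ennreal (p u)"
proof -
  have "ereal (y - u) \<le> T" if "y \<le> u + t" for y
    using order_trans[OF _ assms, of "ereal (y - u)"] that by simp
  then have "{u<..u + t} \<subseteq> shifted_Delta T u"
    by (auto simp: shifted_Delta_eq Delta_def)
  then show ?thesis
    unfolding emeasure_shifted_Delta[symmetric] by (intro emeasure_mono) auto
qed

text \<open>Averaging over a window of width \<open>t\<close> replaces \<open>F(dy)\<close> by \<open>F(u + \<Delta>) du\<close>.\<close>

lemma jump_integral_le:
  assumes t: "0 < t" "t \<le> 1" "ereal t \<le> T" and "0 \<le> h" "0 \<le> c"
    and shift: "\<And>w s. x / 2 \<le> w \<Longrightarrow> 0 \<le> s \<Longrightarrow> s \<le> 1 \<Longrightarrow> p (w - s) \<le> c * p w"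
  shows "(\<integral>\<^sup>+y\<in>{h<..x / 2}. ennreal (p (x - y)) \<partial>M)
    \<le> ennreal (c / t) * (\<integral>\<^sup>+u\<in>{h / 2 - 1..x / 2}. ennreal (p u * p (x - u)) \<partial>lborel)"
proof -
  interpret P: pair_sigma_finite M lborel ..
  \<comment> \<open>Membership means u < y \<le> u + t: read for fixed y it is an interval of
    Lebesgue measure t, read for fixed u it is a window inside u + Delta.\<close>
  let ?W = "\<lambda>y. {u. y - t \<le> u \<and> u < y}"
  have "(\<integral>\<^sup>+y\<in>{h<..x / 2}. ennreal (p (x - y)) \<partial>M)
      \<le> (\<integral>\<^sup>+y. \<integral>\<^sup>+u. ennreal (c / t * p (x - u)) * indicator (?W y) u * indicator {h<..x / 2} y \<partial>lborel \<partial>M)"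
  proof (intro nn_integral_mono)
    fix y
    show "ennreal (p (x - y)) * indicator {h<..x / 2} y
      \<le> (\<integral>\<^sup>+u. ennreal (c / t * p (x - u)) * indicator (?W y) u * indicator {h<..x / 2} y \<partial>lborel)"
    proof (cases "y \<in> {h<..x / 2}")
      case True
      have W: "?W y = {y - t..<y}" by auto
      have "ennreal (p (x - y)) = ennreal (p (x - y) / t) * ennreal t"
        using t by (simp add: ennreal_mult'[symmetric])
      also have "\<dots> = (\<integral>\<^sup>+u. ennreal (p (x - y) / t) * indicator (?W y) u \<partial>lborel)"
        unfolding W using t by (subst nn_integral_cmult_indicator) auto
      also have "\<dots> \<le> (\<integral>\<^sup>+u. ennreal (c / t * p (x - u)) * indicator (?W y) u \<partial>lborel)"
      proof (intro nn_integral_mono)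
        fix u
        \<comment> \<open>Since u < y \<le> x/2, the base point x - u is at least x/2, and the shift
          y - u is at most 1.\<close>
        have "p (x - y) / t \<le> c / t * p (x - u)" if "u \<in> ?W y"
          using shift[of "x - u" "y - u"] that True t by (simp add: divide_right_mono)
        then show "ennreal (p (x - y) / t) * indicator (?W y) u
            \<le> ennreal (c / t * p (x - u)) * indicator (?W y) u"
          by (cases "u \<in> ?W y") (auto intro: ennreal_leI)
      qed
      finally show ?thesis using True by simp
    qed simp
  qed
  also have "\<dots> = (\<integral>\<^sup>+u. \<integral>\<^sup>+y. ennreal (c / t * p (x - u)) * indicator (?W y) u * indicator {h<..x / 2} y \<partial>M \<partial>lborel)"
    by (rule P.Fubini'[symmetric]) measurable
  also have "\<dots> \<le> (\<integral>\<^sup>+u. ennreal (c / t) * (ennreal (p u * p (x - u)) * indicator {h / 2 - 1..x / 2} u) \<partial>lborel)"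
  proof (intro nn_integral_mono)
    fix u
    have "(\<integral>\<^sup>+y. ennreal (c / t * p (x - u)) * indicator (?W y) u * indicator {h<..x / 2} y \<partial>M)
      \<le> (\<integral>\<^sup>+y. (ennreal (c / t * p (x - u)) * indicator {h / 2 - 1..x / 2} u) * indicator {u<..u + t} y \<partial>M)"
      using t assms(4) by (intro nn_integral_mono) (auto simp: indicator_def)
    also have "\<dots> = (ennreal (c / t * p (x - u)) * indicator {h / 2 - 1..x / 2} u) * emeasure M {u<..u + t}"
      by (subst nn_integral_cmult_indicator) auto
    also have "\<dots> \<le> (ennreal (c / t * p (x - u)) * indicator {h / 2 - 1..x / 2} u) * ennreal (p u)"
      by (intro mult_left_mono p_window t) auto
    also have "\<dots> = ennreal (c / t) * (ennreal (p u * p (x - u)) * indicator {h / 2 - 1..x / 2} u)"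
    proof -
      have "ennreal (c / t * p (x - u)) = ennreal (c / t) * ennreal (p (x - u))"
        using assms(5) t by (intro ennreal_mult) auto
      then show ?thesis by (simp only: ennreal_mult p_nonneg mult_ac)
    qed
    finally show "(\<integral>\<^sup>+y. ennreal (c / t * p (x - u)) * indicator (?W y) u * indicator {h<..x / 2} y \<partial>M)
      \<le> ennreal (c / t) * (ennreal (p u * p (x - u)) * indicator {h / 2 - 1..x / 2} u)" .
  qed
  also have "\<dots> = ennreal (c / t) * (\<integral>\<^sup>+u\<in>{h / 2 - 1..x / 2}. ennreal (p u * p (x - u)) \<partial>lborel)"
    by (rule nn_integral_cmult) measurable
  finally show ?thesis .
qed

text \<open>Both terms of \<open>two_jumps_le\<close> are dominated by the integral of p(u) p(x -
  u). Inserting the weights u^\<kappa> and (x - u)^\<kappa>, of orders at least h^\<kappa> and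
  x^\<kappa>, turns it into the convolution of H; the smallness of that convolution gives the factor
  \<eta>.\<close>

lemma two_jumps_Sd:
  assumes Sd: "Sd H" and "0 < \<eta>"
  shows "\<forall>\<^sub>F h in at_top. \<forall>x\<ge>h. R {h<..} (R {h<..} target) x \<le> ennreal (\<eta> * h powr - \<kappa>) * ennreal (p x)"
proof -
  obtain C x0 where C: "1 \<le> C" "1 \<le> x0" "\<And>u v. x0 \<le> u \<Longrightarrow> u \<le> v \<Longrightarrow> p v \<le> C * p u"
    using p_almost_decreasing by metis
  define c where "c = exp (1::real)"
  have c: "0 < c" by (simp add: c_def)
  obtain x1 where x1: "1 \<le> x1" "\<And>w t. x1 \<le> w \<Longrightarrow> 0 \<le> t \<Longrightarrow> t \<le> w powr (1 / \<kappa>) \<Longrightarrow> p (w - t) \<le> c * p w"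
    unfolding c_def using p_insensitive[OF zero_less_one] by metis
  have shift: "p (w - s) \<le> c * p w" if "x1 \<le> w" "0 \<le> s" "s \<le> 1" for w s
  proof -
    have "1 \<le> w powr (1 / \<kappa>)" using that x1(1) kappa by (simp add: ge_one_powr_ge_zero)
    then show ?thesis using x1(2)[of w s] that by simp
  qed
  have "0 < min 1 T" using T_pos by simp
  \<comment> \<open>A real window width is needed even for infinite T, and it must be at most 1 so
    that the unit shift bound applies.\<close>
  then obtain t' where t': "0 < ereal t'" "ereal t' < min 1 T" using ereal_dense2 by blast
  then have t: "0 < t'" "t' \<le> 1" "ereal t' \<le> T" by (auto simp: less_imp_le)
  define K where "K = 2 * (c / t') + C * c"
  have K: "0 < K" unfolding K_def using C(1) c t(1) by (intro add_pos_pos mult_pos_pos divide_pos_pos) auto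
  define \<delta> where "\<delta> = \<eta> / (K * 8 powr \<kappa>)"
  have \<delta>: "0 < \<delta>" using K assms by (simp add: \<delta>_def)
  obtain B x2 where B: "0 < B" "\<And>b x. B \<le> b \<Longrightarrow> x2 \<le> x \<Longrightarrow>
    (\<integral>\<^sup>+u\<in>{b..x / 2}. ennreal (H u * H (x - u)) \<partial>lborel) \<le> ennreal (\<delta> * H x)"
    using Sd_truncated_convolution[OF Sd \<delta>] by blast
  show ?thesis
    using eventually_ge_at_top[of "max (max 4 (2 * B + 2)) (max x2 (2 * x0 + 2 * x1 + 2))"]
  proof eventually_elim
    case (elim h)
    show ?case
    proof (intro allI impI)
      fix x assume x: "h \<le> x"
      \<comment> \<open>Starting at h/2 - 1 makes room for the interval from x/2 - 1 to x/2, over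
        which the square p(x/2)^2 is averaged.\<close>
      let ?D = "{h / 2 - 1..x / 2}"
      let ?G = "\<integral>\<^sup>+u\<in>?D. ennreal (p u * p (x - u)) \<partial>lborel"
      have 1: "(\<integral>\<^sup>+y\<in>{h<..x / 2}. ennreal (p (x - y)) \<partial>M) \<le> ennreal (c / t') * ?G"
        using elim x x1(1) C(2) by (intro jump_integral_le t shift) (auto simp: c_def)
      have 2: "ennreal (p (x / 2) * p (x / 2)) \<le> ennreal (C * c) * ?G"
      proof -
        have "ennreal (p (x / 2) * p (x / 2)) = (\<integral>\<^sup>+u\<in>{x / 2 - 1..x / 2}. ennreal (p (x / 2) * p (x / 2)) \<partial>lborel)"
          by (subst nn_integral_cmult_indicator) auto
        also have "\<dots> \<le> (\<integral>\<^sup>+u. ennreal (C * c) * (ennreal (p u * p (x - u)) * indicator ?D u) \<partial>lborel)"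
        proof (intro nn_integral_mono)
          fix u
          have "p (x / 2) * p (x / 2) \<le> C * c * (p u * p (x - u))" if u: "u \<in> {x / 2 - 1..x / 2}"
          proof -
            have "p (x / 2) \<le> C * p u" using u x elim x1(1) by (intro C(3)) auto
            moreover have "p (x / 2) \<le> c * p (x - u)"
              using shift[of "x - u" "x / 2 - u"] u x elim C(2) by simp
            ultimately have "p (x / 2) * p (x / 2) \<le> (C * p u) * (c * p (x - u))"
              using C(1) by (intro mult_mono) auto
            then show ?thesis by (simp add: mult_ac)
          qed
          then show "ennreal (p (x / 2) * p (x / 2)) * indicator {x / 2 - 1..x / 2} u
              \<le> ennreal (C * c) * (ennreal (p u * p (x - u)) * indicator ?D u)"
            using x C(1) c by (auto simp: indicator_def ennreal_mult'[symmetric] intro!: ennreal_leI)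
        qed
        also have "\<dots> = ennreal (C * c) * ?G" by (rule nn_integral_cmult) measurable
        finally show ?thesis .
      qed
      \<comment> \<open>On \<open>?D\<close> one has u \<ge> h/2 - 1 \<ge> h/4, as h \<ge> 4, and x
        - u \<ge> x/2. The powers 4^\<kappa> and 2^\<kappa> combine to the 8^\<kappa> in
        \<delta>.\<close>
      define E where "E = (h / 4) powr - \<kappa> * (x / 2) powr - \<kappa>"
      have "?G \<le> (\<integral>\<^sup>+u. ennreal E * (ennreal (H u * H (x - u)) * indicator ?D u) \<partial>lborel)"
      proof (intro nn_integral_mono)
        fix u
        have "p u * p (x - u) \<le> E * (H u * H (x - u))" if u: "u \<in> ?D"
        proof -
          have pos: "h / 4 \<le> u" "0 < u" "x / 2 \<le> x - u" "0 < x / 2" "0 < h / 4" using u x elim by auto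
          have "u powr - \<kappa> * (x - u) powr - \<kappa> \<le> E"
            unfolding E_def using pos kappa by (intro mult_mono powr_mono2') auto
          then have "(u powr - \<kappa> * (x - u) powr - \<kappa>) * (H u * H (x - u)) \<le> E * (H u * H (x - u))"
            by (intro mult_right_mono) auto
          moreover have "u powr - \<kappa> * u powr \<kappa> = 1" "(x - u) powr - \<kappa> * (x - u) powr \<kappa> = 1"
            using pos by (simp_all add: powr_add[symmetric])
          then have "(u powr - \<kappa> * (x - u) powr - \<kappa>) * (H u * H (x - u)) = p u * p (x - u)"
            by (simp add: mult_ac)
          ultimately show ?thesis by simp
        qed
        then show "ennreal (p u * p (x - u)) * indicator ?D u
            \<le> ennreal E * (ennreal (H u * H (x - u)) * indicator ?D u)"
          by (auto simp: indicator_def ennreal_mult'[symmetric] E_def intro!: ennreal_leI)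
      qed
      also have "\<dots> = ennreal E * (\<integral>\<^sup>+u\<in>?D. ennreal (H u * H (x - u)) \<partial>lborel)"
        by (rule nn_integral_cmult) measurable
      also have "\<dots> \<le> ennreal E * ennreal (\<delta> * H x)"
        using x elim by (intro mult_left_mono B(2)) auto
      also have "\<dots> = ennreal (E * (\<delta> * H x))"
        by (simp add: E_def ennreal_mult'[symmetric])
      also have "E * (\<delta> * H x) = \<eta> * h powr - \<kappa> * p x / K"
      proof -
        have "(h / 4) powr - \<kappa> = 4 powr \<kappa> * h powr - \<kappa>" "(x / 2) powr - \<kappa> = 2 powr \<kappa> * x powr - \<kappa>"
          using x elim by (simp_all add: powr_divide powr_minus divide_simps)
        moreover have "x powr - \<kappa> * x powr \<kappa> = 1" using x elim by (simp add: powr_add[symmetric])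
        moreover have "(4::real) powr \<kappa> * 2 powr \<kappa> = 8 powr \<kappa>" by (simp add: powr_mult[symmetric])
        ultimately have "E * (\<delta> * H x) = 8 powr \<kappa> * h powr - \<kappa> * \<delta> * p x"
          unfolding E_def by (simp add: mult_ac)
        then show ?thesis by (simp add: \<delta>_def)
      qed
      finally have G: "?G \<le> ennreal (\<eta> * h powr - \<kappa> * p x / K)" .
      have "R {h<..} (R {h<..} target) x \<le> 2 * (ennreal (c / t') * ?G) + ennreal (C * c) * ?G"
        by (intro order_trans[OF two_jumps_le] add_mono mult_left_mono 1 2) auto
      also have "\<dots> = ennreal K * ?G"
      proof -
        have "ennreal K = ennreal (2 * (c / t')) + ennreal (C * c)"
          unfolding K_def using c t(1) C(1) by (intro ennreal_plus) auto
        also have "ennreal (2 * (c / t')) = 2 * ennreal (c / t')"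
          using c t(1) by (subst ennreal_mult) auto
        finally show ?thesis by (simp only: distrib_right mult.assoc)
      qed
      also have "\<dots> \<le> ennreal K * ennreal (\<eta> * h powr - \<kappa> * p x / K)"
        by (intro mult_left_mono G) auto
      also have "\<dots> = ennreal (\<eta> * h powr - \<kappa>) * ennreal (p x)"
        using K assms by (simp add: ennreal_mult'[symmetric])
      finally show "R {h<..} (R {h<..} target) x \<le> ennreal (\<eta> * h powr - \<kappa>) * ennreal (p x)" .
    qed
  qed
qed

lemma two_jumps_negligible:
  assumes "Sd H \<or> O_regularly_varying H" "0 < \<eta>"
  shows "\<forall>\<^sub>F h in at_top. \<forall>x. R {h<..} (R {h<..} target) x \<le> ennreal (\<eta> * h powr - \<kappa>) * R {h<..} target x"
proof -
  have *: "\<forall>\<^sub>F h in at_top. \<forall>x\<ge>h. R {h<..} (R {h<..} target) x \<le> ennreal (\<eta> * h powr - \<kappa>) * ennreal (p x)"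
    using assms two_jumps_Sd two_jumps_regularly_varying by blast
  have "\<forall>\<^sub>F h in at_top. T = \<infinity> \<or> T \<le> ereal h"
  proof (cases T)
    case (real r)
    show ?thesis
      using eventually_ge_at_top[of r] by eventually_elim (simp add: real)
  qed (use T_pos in auto)
  with * eventually_ge_at_top[of 0] show ?thesis
  proof eventually_elim
    case (elim h)
    show ?case
    proof
      fix x
      show "R {h<..} (R {h<..} target) x \<le> ennreal (\<eta> * h powr - \<kappa>) * R {h<..} target x"
        by (rule two_jumps_le_all) (use elim in auto)
    qed
  qed
qed

end

subsection \<open>Estimates at the natural scale\<close>

context big_jump_distribution
begin

text \<open>Chernoff's bound at the natural scale: with w = z - S for the sum S of j steps, the
  event is s S > K, that is, a deviation of S by more than K h in the direction given by the sign of
  \<open>s\<close>.\<close>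

lemma deviation_le:
  assumes "0 < h" and s: "\<bar>s\<bar> = 1 / h" and j: "real j \<le> h powr \<kappa>"
  shows "(R UNIV ^^ j) (indicator {w. K < s * (z - w)}) z
    \<le> ennreal (exp (m - K) + real j * prob {y. h < \<bar>y\<bar>})"
proof -
  let ?A = "{y. s * y \<le> 1}" and ?f = "indicator {w. K < s * (z - w)} :: real \<Rightarrow> ennreal"
  have sk: "\<bar>s\<bar> powr \<kappa> = 1 / h powr \<kappa>" using assms by (simp add: powr_divide)
  have "real j * \<bar>s\<bar> powr \<kappa> \<le> 1" using j assms(1) by (simp add: sk)
  then have jm: "real j * \<bar>s\<bar> powr \<kappa> * m \<le> 1 * m" using m_nonneg by (rule mult_right_mono)
  have "?f w \<le> ennreal (exp (s * z - K)) * ennreal (exp (- s * w))" for w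
  proof (cases "K < s * (z - w)")
    case True
    then have "0 \<le> s * z - K + - s * w" by (simp add: algebra_simps)
    then have "1 \<le> exp (s * z - K + - s * w)" by (simp only: one_le_exp_iff)
    then show ?thesis using True by (simp add: ennreal_mult'[symmetric] exp_add[symmetric])
  qed simp
  then have "(R ?A ^^ j) ?f z \<le> (R ?A ^^ j) (\<lambda>w. ennreal (exp (s * z - K)) * ennreal (exp (- s * w))) z"
    by (intro restricted_conv_power_mono) auto
  also have "\<dots> = ennreal (exp (s * z - K)) * (R ?A ^^ j) (\<lambda>w. ennreal (exp (- s * w))) z"
    by (rule restricted_conv_power_cmult) measurable
  also have "\<dots> \<le> ennreal (exp (s * z - K)) * ennreal (exp (- s * z) * exp (j * \<bar>s\<bar> powr \<kappa> * m))"
    by (intro mult_left_mono restricted_conv_power_exp_le) auto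
  also have "\<dots> = ennreal (exp (real j * \<bar>s\<bar> powr \<kappa> * m - K))"
    by (simp add: ennreal_mult'[symmetric] exp_add[symmetric])
  also have "\<dots> \<le> ennreal (exp (m - K))"
    using jm by (intro ennreal_leI) simp
  finally have 1: "(R ?A ^^ j) ?f z \<le> ennreal (exp (m - K))" .
  \<comment> \<open>Whatever the sign of \<open>s\<close>, a step removed by the truncation exceeds
    h in absolute value.\<close>
  have "- ?A \<subseteq> {y. h < \<bar>y\<bar>}"
  proof
    fix y assume "y \<in> - ?A"
    then have "1 < \<bar>s\<bar> * \<bar>y\<bar>" by (simp add: abs_mult[symmetric])
    then show "y \<in> {y. h < \<bar>y\<bar>}" using assms by (simp add: s field_simps)
  qed
  then have 2: "emeasure M (- ?A) \<le> ennreal (prob {y. h < \<bar>y\<bar>})"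
    unfolding emeasure_eq_measure[symmetric] by (intro emeasure_mono) auto
  have "(R UNIV ^^ j) ?f z \<le> (R ?A ^^ j) ?f z + of_nat j * emeasure M (- ?A)"
    by (rule conv_power_le_restricted) (auto simp: indicator_def)
  also have "\<dots> \<le> ennreal (exp (m - K)) + of_nat j * ennreal (prob {y. h < \<bar>y\<bar>})"
    by (intro add_mono mult_left_mono 1 2) auto
  also have "\<dots> = ennreal (exp (m - K) + real j * prob {y. h < \<bar>y\<bar>})"
    by (simp add: ennreal_of_nat_eq_real_of_nat ennreal_mult'[symmetric])
  finally show ?thesis .
qed

abbreviation big :: "real \<Rightarrow> real \<Rightarrow> ennreal" where
  "big h \<equiv> R {h<..} target"

lemma big_measurable [measurable]: "big h \<in> borel_measurable borel"
  by measurable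

lemma big_le_1: "big h w \<le> 1"
  using order_trans[OF restricted_conv_target_le ennreal_leI[OF p_le_1]] by simp

definition natural_scale :: "nat \<Rightarrow> real" where "natural_scale n = real n powr (1 / \<kappa>)"

lemma natural_scale_powr: "natural_scale n powr \<kappa> = real n"
  using kappa by (simp add: natural_scale_def powr_powr)

lemma natural_scale_pos: "0 < n \<Longrightarrow> 0 < natural_scale n"
  by (simp add: natural_scale_def)

lemma natural_scale_at_top: "filterlim natural_scale at_top sequentially"
  unfolding natural_scale_def[abs_def]
  by (rule filterlim_compose[OF real_powr_at_top filterlim_real_sequentially]) (use kappa in auto)

text \<open>For z \<ge> a n one has z/h \<ge> a^(1/\<kappa>) z^\<beta> with \<beta> = 1 -
  1/\<kappa>, which dominates the exponent in \<open>p_lower_bound\<close>. One half of the exponent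
  is used against \<open>p z\<close>, the other half supplies \<eta>.\<close>

lemma exp_scale_le:
  assumes "0 < a" "0 < \<eta>"
  shows "\<forall>\<^sub>F n in sequentially. \<forall>z\<ge>a * real n. exp (- (z / (2 * natural_scale n))) \<le> \<eta> * p z"
proof -
  \<comment> \<open>Chosen so that z / (2h) \<ge> 2\<theta> z^\<beta>.\<close>
  define \<theta> where "\<theta> = a powr (1 / \<kappa>) / 4"
  have \<theta>: "0 < \<theta>" using assms by (simp add: \<theta>_def)
  define \<beta> where "\<beta> = 1 - 1 / \<kappa>"
  have \<beta>: "0 < \<beta>" using kappa by (simp add: \<beta>_def)
  obtain c x0 where c: "0 < c" "1 \<le> x0" "\<And>v. x0 \<le> v \<Longrightarrow> c * exp (- \<theta> * v powr \<beta>) \<le> p v"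
    unfolding \<beta>_def using p_lower_bound[OF \<theta>] by blast
  have lim: "filterlim (\<lambda>n. a * real n) at_top sequentially"
    using assms by (intro filterlim_tendsto_pos_mult_at_top[OF tendsto_const _ filterlim_real_sequentially])
  have "((\<lambda>x. exp (- \<theta> * x powr \<beta>)) \<longlongrightarrow> 0) at_top"
  proof (rule filterlim_compose[OF exp_at_bot])
    show "filterlim (\<lambda>x. - \<theta> * x powr \<beta>) at_bot at_top"
      by (rule filterlim_tendsto_neg_mult_at_bot[OF tendsto_const _ real_powr_at_top[OF \<beta>]])
         (use \<theta> in simp)
  qed
  then have "\<forall>\<^sub>F x in at_top. exp (- \<theta> * x powr \<beta>) < \<eta> * c"
    by (rule order_tendstoD(2)) (use assms c in simp)
  then have "\<forall>\<^sub>F x in at_top. exp (- \<theta> * x powr \<beta>) < \<eta> * c \<and> x0 \<le> x"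
    using eventually_ge_at_top by (rule eventually_conj)
  then have "\<forall>\<^sub>F n in sequentially. exp (- \<theta> * (a * real n) powr \<beta>) < \<eta> * c \<and> x0 \<le> a * real n"
    using lim unfolding filterlim_iff by blast
  then show ?thesis
    using eventually_gt_at_top[of 0]
  proof eventually_elim
    case (elim n)
    show ?case
    proof (intro allI impI)
      fix z assume z: "a * real n \<le> z"
      have pos: "0 < a * real n" using assms elim by simp
      have sc: "0 < natural_scale n" using natural_scale_pos elim by simp
      have "(a * real n) powr (1 / \<kappa>) \<le> z powr (1 / \<kappa>)"
        using pos z kappa by (intro powr_mono2) auto
      then have "a powr (1 / \<kappa>) * natural_scale n \<le> z powr (1 / \<kappa>)"
        using assms by (simp add: natural_scale_def powr_mult)
      then have "a powr (1 / \<kappa>) * natural_scale n * z powr \<beta> \<le> z powr (1 / \<kappa>) * z powr \<beta>"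
        by (intro mult_right_mono) auto
      also have "\<dots> = z" using pos z by (simp add: powr_add[symmetric] \<beta>_def)
      finally have "2 * (\<theta> * z powr \<beta>) \<le> z / (2 * natural_scale n)"
        using sc by (simp add: \<theta>_def field_simps)
      then have "exp (- (z / (2 * natural_scale n))) \<le> exp (- \<theta> * z powr \<beta>) * exp (- \<theta> * z powr \<beta>)"
        by (simp add: exp_add[symmetric])
      also have "\<dots> \<le> (\<eta> * c) * exp (- \<theta> * z powr \<beta>)"
      proof (intro mult_right_mono)
        have "(a * real n) powr \<beta> \<le> z powr \<beta>" using pos z \<beta> by (intro powr_mono2) auto
        then have "exp (- \<theta> * z powr \<beta>) \<le> exp (- \<theta> * (a * real n) powr \<beta>)" using \<theta> by simp
        then show "exp (- \<theta> * z powr \<beta>) \<le> \<eta> * c" using elim by linarith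
      qed simp
      also have "\<dots> \<le> \<eta> * p z"
        using c(3)[of z] z elim assms by (simp add: mult.assoc)
      finally show "exp (- (z / (2 * natural_scale n))) \<le> \<eta> * p z" .
    qed
  qed
qed

lemma scaled_tail_prob_le:
  assumes "0 < \<eta>"
  shows "\<forall>\<^sub>F n in sequentially. real n * prob {y. natural_scale n < \<bar>y\<bar>} \<le> \<eta>"
proof -
  have "\<forall>\<^sub>F n in sequentially. prob {y. natural_scale n < \<bar>y\<bar>} \<le> \<eta> * natural_scale n powr - \<kappa>"
    using tail_prob_le[OF assms] natural_scale_at_top unfolding filterlim_iff by blast
  then show ?thesis
    using eventually_gt_at_top[of 0]
  proof eventually_elim
    case (elim n)
    then show ?case by (simp add: powr_minus natural_scale_powr divide_simps mult.commute)
  qed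
qed

text \<open>Beyond a n the admissible shift u^(1/\<kappa>) is at least a^(1/\<kappa>) h, so
  distances can be measured in units of h with one constant for all such points.\<close>

lemma p_ratio_scale:
  assumes "0 < a" "0 < \<epsilon>"
  shows "\<forall>\<^sub>F n in sequentially. \<forall>z w. a * real n \<le> z \<longrightarrow> a * real n \<le> w \<longrightarrow>
    p w \<le> exp (\<epsilon> * (1 + \<bar>z - w\<bar> / (a powr (1 / \<kappa>) * natural_scale n))) * p z"
proof -
  obtain x0 where x0: "1 \<le> x0"
    "\<And>u v. x0 \<le> u \<Longrightarrow> u \<le> v \<Longrightarrow>
      p u \<le> exp (\<epsilon> * (1 + (v - u) / u powr (1 / \<kappa>))) * p v \<and>
      p v \<le> exp (\<epsilon> * (1 + (v - u) / u powr (1 / \<kappa>))) * p u"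
    using p_ratio_bound[OF assms(2)] by metis
  have "filterlim (\<lambda>n. a * real n) at_top sequentially"
    using assms by (intro filterlim_tendsto_pos_mult_at_top[OF tendsto_const _ filterlim_real_sequentially])
  then have "\<forall>\<^sub>F n in sequentially. x0 \<le> a * real n"
    using eventually_ge_at_top unfolding filterlim_iff by blast
  then show ?thesis
    using eventually_gt_at_top[of 0]
  proof eventually_elim
    case (elim n)
    show ?case
    proof (intro allI impI)
      fix z w assume zw: "a * real n \<le> z" "a * real n \<le> w"
      let ?u = "min z w"
      have pos: "0 < a * real n" using assms elim by simp
      have "(a * real n) powr (1 / \<kappa>) \<le> ?u powr (1 / \<kappa>)"
        using pos zw kappa by (intro powr_mono2) auto
      then have le: "a powr (1 / \<kappa>) * natural_scale n \<le> ?u powr (1 / \<kappa>)"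
        using assms by (simp add: natural_scale_def powr_mult)
      have pos': "0 < a powr (1 / \<kappa>) * natural_scale n" using assms elim natural_scale_pos by simp
      have "\<bar>z - w\<bar> / ?u powr (1 / \<kappa>) \<le> \<bar>z - w\<bar> / (a powr (1 / \<kappa>) * natural_scale n)"
        using pos' le by (intro divide_left_mono[OF le abs_ge_zero] mult_pos_pos[OF _ pos']) linarith
      then have "exp (\<epsilon> * (1 + \<bar>z - w\<bar> / ?u powr (1 / \<kappa>))) * p z
          \<le> exp (\<epsilon> * (1 + \<bar>z - w\<bar> / (a powr (1 / \<kappa>) * natural_scale n))) * p z"
        using assms by (intro mult_right_mono) auto
      moreover have "p w \<le> exp (\<epsilon> * (1 + \<bar>z - w\<bar> / ?u powr (1 / \<kappa>))) * p z"
      proof (cases "z \<le> w")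
        case True
        then show ?thesis using x0(2)[of z w] zw elim by (simp add: min_def)
      next
        case False
        then show ?thesis using x0(2)[of w z] zw elim by (simp add: min_def)
      qed
      ultimately show "p w \<le> exp (\<epsilon> * (1 + \<bar>z - w\<bar> / (a powr (1 / \<kappa>) * natural_scale n))) * p z"
        by (rule order_trans[rotated])
    qed
  qed
qed

text \<open>The jump profile at w = z - S is dominated by three test functions. Near z a constant
  suffices; for w > z + K h almost monotonicity and a deviation bound do. For w < z - K h the
  profile may grow like exp((z - w)/(2h)), so an exponential replaces the indicator. Far below, at w
  < a n/2, the profile is bounded by 1, and reaching there costs exp(-z/(2h)). The five resulting
  errors receive \<epsilon>/5 each.\<close>

lemma one_jump_upper:
  assumes "0 < a" "0 < \<epsilon>"
  shows "\<forall>\<^sub>F n in sequentially. \<forall>z\<ge>a * real n. \<forall>j\<le>n.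
    (R {..natural_scale n} ^^ j) (big (natural_scale n)) z \<le> ennreal ((1 + \<epsilon>) * p z)"
proof -
  obtain C x0 where C: "1 \<le> C" "1 \<le> x0" "\<And>u v. x0 \<le> u \<Longrightarrow> u \<le> v \<Longrightarrow> p v \<le> C * p u"
    using p_almost_decreasing by metis
  define c where "c = (a / 2) powr (1 / \<kappa>)"
  have c: "0 < c" using assms by (simp add: c_def)
  have "((\<lambda>K. C * exp (m - K)) \<longlongrightarrow> 0) at_top"
    by real_asymp
  then have "\<forall>\<^sub>F K in at_top. C * exp (m - K) < \<epsilon> / 5"
    by (rule order_tendstoD(2)) (use assms in simp)
  moreover have "((\<lambda>K. exp (1 + m - K / 2)) \<longlongrightarrow> 0) at_top"
    by real_asymp
  then have "\<forall>\<^sub>F K in at_top. exp (1 + m - K / 2) < \<epsilon> / 5"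
    by (rule order_tendstoD(2)) (use assms in simp)
  ultimately have "\<forall>\<^sub>F K in at_top. C * exp (m - K) < \<epsilon> / 5 \<and> exp (1 + m - K / 2) < \<epsilon> / 5 \<and> 0 \<le> K"
    using eventually_ge_at_top[of 0] by eventually_elim auto
  then obtain K where K: "C * exp (m - K) < \<epsilon> / 5" "exp (1 + m - K / 2) < \<epsilon> / 5" "0 \<le> K"
    unfolding eventually_at_top_linorder by blast
  \<comment> \<open>The bound c/2 keeps the growth rate e/c at most 1/2; the logarithmic one keeps
    the ratio within distance K h below 1 + \<epsilon>/5; the bound 1 makes the choice of K
    independent of e.\<close>
  define e where "e = min (min 1 (c / 2)) (ln (1 + \<epsilon> / 5) / (1 + K / c))"
  have Kc: "0 < 1 + K / c" using K c by (simp add: add_pos_nonneg)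
  have le: "e \<le> 1" "e \<le> c / 2" "e \<le> ln (1 + \<epsilon> / 5) / (1 + K / c)"
    unfolding e_def by linarith+
  have e: "0 < e" "e \<le> 1" "e / c \<le> 1 / 2"
  proof -
    have "0 < ln (1 + \<epsilon> / 5) / (1 + K / c)" using assms Kc by (intro divide_pos_pos ln_gt_zero) auto
    then show "0 < e" using c by (simp add: e_def)
  qed (use le(1,2) c in \<open>auto simp: divide_le_eq\<close>)
  have "e * (1 + K / c) \<le> ln (1 + \<epsilon> / 5)"
    using le(3) Kc by (simp add: pos_le_divide_eq)
  then have eK: "exp (e * (1 + K / c)) \<le> 1 + \<epsilon> / 5"
    using assms by (metis add_pos_pos divide_pos_pos exp_le_cancel_iff exp_ln zero_less_numeral zero_less_one)
  have eC: "0 < \<epsilon> / 5 / C" using assms C by simp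
  have em: "0 < \<epsilon> / 5 / exp m" using assms by simp
  have "filterlim (\<lambda>n. a / 2 * real n) at_top sequentially"
    using assms by (intro filterlim_tendsto_pos_mult_at_top[OF tendsto_const _ filterlim_real_sequentially]) auto
  then have "\<forall>\<^sub>F n in sequentially. x0 \<le> a / 2 * real n"
    using eventually_ge_at_top unfolding filterlim_iff by blast
  moreover have "\<forall>\<^sub>F n in sequentially. \<forall>z w. a / 2 * real n \<le> z \<longrightarrow> a / 2 * real n \<le> w \<longrightarrow>
    p w \<le> exp (e * (1 + \<bar>z - w\<bar> / (c * natural_scale n))) * p z"
    unfolding c_def using assms by (intro p_ratio_scale e) auto
  moreover note exp_scale_le[OF assms(1) em] scaled_tail_prob_le[OF eC] eventually_gt_at_top[of 0]
  ultimately show ?thesis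
  proof eventually_elim
    case (elim n)
    define h where "h = natural_scale n"
    have h: "0 < h" "h powr \<kappa> = real n"
      using elim(5) by (auto simp: h_def natural_scale_pos natural_scale_powr)
    have A: "{y. 1 / h * y \<le> 1} = {..h}" using h by (auto simp: field_simps)
    show ?case
      unfolding h_def[symmetric]
    proof (intro allI impI)
      fix z j assume z: "a * real n \<le> z" and j: "j \<le> n"
      have z0: "0 < z" "a / 2 * real n \<le> z / 2" "x0 \<le> z"
        using z elim(5) elim(1) assms C(2) by (auto intro: less_le_trans)
      have hz: "a / 2 * real n \<le> z" using z0 by simp
      have Kh: "0 \<le> K * h" using K h by simp
      let ?I = "indicator {w. K < - 1 / h * (z - w)} :: real \<Rightarrow> ennreal"
      let ?L = "\<lambda>w. ennreal (exp (- (1 / h) * w))"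
      \<comment> \<open>The two summands serve w < z - K h and w < a n/2; the factor exp(z/h)
        recentres exp(-w/h) to exp((z - w)/h).\<close>
      define b where "b = (exp (e - K / 2) * p z + exp (- (z / (2 * h)))) * exp (z / h)"
      have b: "0 \<le> b" by (simp add: b_def)
      have pw: "big h w \<le> ennreal ((1 + \<epsilon> / 5) * p z) + (ennreal (C * p z) * ?I w + ennreal b * ?L w)" for w
      proof -
        consider "w < a / 2 * real n" | "a / 2 * real n \<le> w" "\<bar>z - w\<bar> \<le> K * h"
          | "a / 2 * real n \<le> w" "K * h < w - z" | "a / 2 * real n \<le> w" "K * h < z - w" by linarith
        then show ?thesis
        proof cases
          case 1
          have "1 \<le> exp (- (z / (2 * h)) + z / h + - (1 / h) * w)"
            using 1 z0 h by (simp add: field_simps)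
          also have "\<dots> = exp (- (z / (2 * h))) * exp (z / h) * exp (- (1 / h) * w)"
            by (simp only: exp_add)
          also have "\<dots> \<le> b * exp (- (1 / h) * w)"
            unfolding b_def by (intro mult_right_mono) auto
          finally have "1 \<le> ennreal b * ?L w"
            using b by (simp add: ennreal_mult'[symmetric])
          then have "big h w \<le> ennreal b * ?L w" using big_le_1[of h w] by (rule order_trans[rotated])
          then show ?thesis by (simp add: add_increasing)
        next
          case 2
          have "p w \<le> exp (e * (1 + \<bar>z - w\<bar> / (c * h))) * p z"
            using elim(2) hz 2(1) by (simp add: h_def)
          also have "\<bar>z - w\<bar> / (c * h) \<le> K / c" using 2(2) c h by (simp add: field_simps)
          then have "exp (e * (1 + \<bar>z - w\<bar> / (c * h))) \<le> exp (e * (1 + K / c))" using e by simp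
          then have "exp (e * (1 + \<bar>z - w\<bar> / (c * h))) * p z \<le> (1 + \<epsilon> / 5) * p z"
            by (intro mult_right_mono order_trans[OF _ eK] p_nonneg)
          finally have "p w \<le> (1 + \<epsilon> / 5) * p z" .
          then have "big h w \<le> ennreal ((1 + \<epsilon> / 5) * p z)"
            by (intro order_trans[OF restricted_conv_target_le] ennreal_leI) auto
          then show ?thesis by (simp add: add_increasing2)
        next
          case 3
          have "K < (w - z) / h" using 3(2) h by (simp add: pos_less_divide_eq)
          also have "(w - z) / h = - 1 / h * (z - w)" by (simp add: diff_divide_distrib)
          finally have "w \<in> {w. K < - 1 / h * (z - w)}" by simp
          moreover have "z \<le> w" using 3(2) Kh by linarith
          ultimately have "big h w \<le> ennreal (C * p z) * ?I w"
            using C(3)[of z w] z0 by (auto intro!: order_trans[OF restricted_conv_target_le] ennreal_leI)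
          then show ?thesis by (simp add: add_increasing add_increasing2)
        next
          case 4
          have Kz: "0 \<le> z - w" "K \<le> (z - w) / h"
            using 4(2) Kh h by (linarith, simp add: pos_le_divide_eq)
          have "p w \<le> exp (e * (1 + \<bar>z - w\<bar> / (c * h))) * p z"
            using elim(2) hz 4(1) by (simp add: h_def)
          also have "e * (1 + \<bar>z - w\<bar> / (c * h)) = e + e / c * ((z - w) / h)"
            using Kz by (simp add: distrib_left)
          also have "exp (e + e / c * ((z - w) / h)) \<le> exp ((e - K / 2) + z / h + - (1 / h) * w)"
          proof -
            \<comment> \<open>Half of (z - w)/h pays for the growth of \<open>p\<close>; the other
              half is at least K/2 and yields the small factor exp(-K/2).\<close>
            have "e / c * ((z - w) / h) \<le> 1 / 2 * ((z - w) / h)"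
              using e Kz h by (intro mult_right_mono) auto
            then show ?thesis using Kz(2) by (simp add: diff_divide_distrib)
          qed
          also have "\<dots> = exp (e - K / 2) * exp (z / h) * exp (- (1 / h) * w)"
            by (simp only: exp_add)
          finally have "p w \<le> exp (e - K / 2) * exp (z / h) * exp (- (1 / h) * w) * p z"
            by (simp add: mult_right_mono)
          also have "\<dots> = (exp (e - K / 2) * p z) * exp (z / h) * exp (- (1 / h) * w)"
            by (simp only: mult_ac)
          also have "\<dots> \<le> b * exp (- (1 / h) * w)"
            unfolding b_def by (intro mult_right_mono) auto
          finally have "big h w \<le> ennreal b * ?L w"
            using b by (auto simp: ennreal_mult'[symmetric] intro!: order_trans[OF restricted_conv_target_le] ennreal_leI)
          then show ?thesis by (simp add: add_increasing)
        qed
      qed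
      have jn: "real j \<le> h powr \<kappa>" using j h by simp
      have I: "(R {..h} ^^ j) ?I z \<le> ennreal (exp (m - K) + \<epsilon> / 5 / C)"
      proof -
        have "(R {..h} ^^ j) ?I z \<le> (R UNIV ^^ j) ?I z"
          by (rule restricted_conv_power_mono) auto
        also have "\<dots> \<le> ennreal (exp (m - K) + real j * prob {y. h < \<bar>y\<bar>})"
          by (rule deviation_le) (use h jn in auto)
        also have "\<dots> \<le> ennreal (exp (m - K) + \<epsilon> / 5 / C)"
        proof (intro ennreal_leI add_left_mono)
          have "real j * prob {y. h < \<bar>y\<bar>} \<le> real n * prob {y. h < \<bar>y\<bar>}"
            using j by (intro mult_right_mono) auto
          then show "real j * prob {y. h < \<bar>y\<bar>} \<le> \<epsilon> / 5 / C" using elim(4) by (simp add: h_def)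
        qed
        finally show ?thesis .
      qed
      have L: "(R {..h} ^^ j) ?L z \<le> ennreal (exp (- (1 / h) * z) * exp m)"
      proof -
        have "\<bar>1 / h\<bar> powr \<kappa> = 1 / real n" using h by (simp add: powr_divide)
        then have "real j * \<bar>1 / h\<bar> powr \<kappa> * m \<le> 1 * m"
          using j elim(5) m_nonneg by (intro mult_right_mono) auto
        then have "exp (- (1 / h) * z) * exp (real j * \<bar>1 / h\<bar> powr \<kappa> * m) \<le> exp (- (1 / h) * z) * exp m"
          by simp
        then show ?thesis
          using restricted_conv_power_exp_le[where s = "1 / h" and n = j and x = z]
          unfolding A by (meson ennreal_leI order_trans)
      qed
      have one: "(R {..h} ^^ j) (\<lambda>w. ennreal ((1 + \<epsilon> / 5) * p z)) z \<le> ennreal ((1 + \<epsilon> / 5) * p z)"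
        using restricted_conv_power_mono[of "{..h}" UNIV "\<lambda>w. ennreal ((1 + \<epsilon> / 5) * p z)" "\<lambda>w. ennreal ((1 + \<epsilon> / 5) * p z)" j z]
        by (simp only: restricted_conv_power_const) simp
      have "(R {..h} ^^ j) (big h) z
          \<le> (R {..h} ^^ j) (\<lambda>w. ennreal ((1 + \<epsilon> / 5) * p z) + (ennreal (C * p z) * ?I w + ennreal b * ?L w)) z"
        by (rule restricted_conv_power_mono[OF _ pw]) auto
      also have "\<dots> = (R {..h} ^^ j) (\<lambda>w. ennreal ((1 + \<epsilon> / 5) * p z)) z
          + (ennreal (C * p z) * (R {..h} ^^ j) ?I z + ennreal b * (R {..h} ^^ j) ?L z)"
        by (simp add: restricted_conv_power_add restricted_conv_power_cmult)
      also have "\<dots> \<le> ennreal ((1 + \<epsilon> / 5) * p z)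
          + (ennreal (C * p z) * ennreal (exp (m - K) + \<epsilon> / 5 / C) + ennreal b * ennreal (exp (- (1 / h) * z) * exp m))"
        by (intro add_mono mult_left_mono one I L) auto
      also have "\<dots> = ennreal ((1 + \<epsilon> / 5) * p z + (C * p z * (exp (m - K) + \<epsilon> / 5 / C) + b * (exp (- (1 / h) * z) * exp m)))"
        using assms C(1) b by (simp add: ennreal_mult ennreal_plus)
      also have "\<dots> \<le> ennreal ((1 + \<epsilon>) * p z)"
      proof (rule ennreal_leI)
        have 1: "C * p z * (exp (m - K) + \<epsilon> / 5 / C) \<le> (2 * \<epsilon> / 5) * p z"
        proof -
          have "C * p z * (exp (m - K) + \<epsilon> / 5 / C) = (C * exp (m - K) + \<epsilon> / 5) * p z"
            using C(1) by (simp add: field_simps)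
          also have "\<dots> \<le> (2 * \<epsilon> / 5) * p z" using K(1) by (intro mult_right_mono) auto
          finally show ?thesis .
        qed
        have "b * (exp (- (1 / h) * z) * exp m) = (exp (e - K / 2) * p z + exp (- (z / (2 * h)))) * exp m"
          by (simp add: b_def exp_minus)
        also have "\<dots> = exp (e + m - K / 2) * p z + exp (- (z / (2 * h))) * exp m"
          by (simp add: distrib_right exp_add exp_diff)
        also have "\<dots> \<le> \<epsilon> / 5 * p z + \<epsilon> / 5 * p z"
        proof (intro add_mono mult_right_mono)
          have "exp (e + m - K / 2) \<le> exp (1 + m - K / 2)" using e by simp
          then show "exp (e + m - K / 2) \<le> \<epsilon> / 5" using K(2) by linarith
          have "exp (- (z / (2 * h))) \<le> \<epsilon> / 5 / exp m * p z" using elim(3) z by (simp add: h_def)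
          then show "exp (- (z / (2 * h))) * exp m \<le> \<epsilon> / 5 * p z" by (simp add: field_simps)
        qed auto
        finally show "(1 + \<epsilon> / 5) * p z + (C * p z * (exp (m - K) + \<epsilon> / 5 / C) + b * (exp (- (1 / h) * z) * exp m))
            \<le> (1 + \<epsilon>) * p z"
          using 1 by (simp add: algebra_simps)
      qed
      finally show "(R {..h} ^^ j) (big h) z \<le> ennreal ((1 + \<epsilon>) * p z)" .
    qed
  qed
qed

text \<open>Only the paths with |S| \<le> K h are used. The inequality is arranged without
  subtraction: the constant is at most the profile plus the two deviation indicators, and the mass
  lost by truncating the steps is added separately.\<close>

lemma one_jump_lower:
  assumes "0 < a" "0 < \<epsilon>"
  shows "\<forall>\<^sub>F n in sequentially. \<forall>z\<ge>a * real n. \<forall>j\<le>n.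
    ennreal ((1 - \<epsilon>) * p z) \<le> (R {..natural_scale n} ^^ j) (big (natural_scale n)) z"
proof -
  define c where "c = (a / 2) powr (1 / \<kappa>)"
  have c: "0 < c" using assms by (simp add: c_def)
  have "((\<lambda>K. exp (m - K)) \<longlongrightarrow> 0) at_top"
    by real_asymp
  then have "\<forall>\<^sub>F K in at_top. exp (m - K) < \<epsilon> / 8"
    by (rule order_tendstoD(2)) (use assms in simp)
  then have "\<forall>\<^sub>F K in at_top. exp (m - K) < \<epsilon> / 8 \<and> 0 \<le> K"
    using eventually_ge_at_top[of 0] by eventually_elim auto
  then obtain K where K: "exp (m - K) < \<epsilon> / 8" "0 \<le> K"
    unfolding eventually_at_top_linorder by blast
  have Kc: "0 < 1 + K / c" using K c by (simp add: add_pos_nonneg)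
  \<comment> \<open>Within distance K h the ratio bound then costs exactly
    exp(\<epsilon>/4).\<close>
  define e where "e = \<epsilon> / 4 / (1 + K / c)"
  have cancel: "y / x * x = y" if "0 < x" for x y :: real
    using that by simp
  have e: "0 < e" "e * (1 + K / c) = \<epsilon> / 4"
    unfolding e_def using assms Kc by (simp, intro cancel)
  define E where "E = exp (- (\<epsilon> / 4))"
  have E: "0 < E" "1 - \<epsilon> / 4 \<le> E" "E \<le> 1"
    using assms exp_ge_add_one_self[of "- (\<epsilon> / 4)"] by (auto simp: E_def)
  \<comment> \<open>The errors add up as 2(\<epsilon>/8 + \<epsilon>/12) + \<epsilon>/12 =
    \<epsilon>/2; together with E \<ge> 1 - \<epsilon>/4 this stays within \<epsilon>.\<close>
  have e12: "0 < \<epsilon> / 12" using assms by simp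
  \<comment> \<open>Since n/h tends to infinity, eventually (K + 1) h \<le> a n/2. Points within K h
    of z are then above h, where the profile equals \<open>p\<close>.\<close>
  have "filterlim (\<lambda>n. a / 2 * real n powr (1 - 1 / \<kappa>)) at_top sequentially"
    using assms kappa
    by (intro filterlim_tendsto_pos_mult_at_top[OF tendsto_const]
        filterlim_compose[OF real_powr_at_top filterlim_real_sequentially]) auto
  then have "\<forall>\<^sub>F n in sequentially. K + 1 \<le> a / 2 * real n powr (1 - 1 / \<kappa>)"
    using eventually_ge_at_top unfolding filterlim_iff by blast
  moreover have "\<forall>\<^sub>F n in sequentially. \<forall>z w. a / 2 * real n \<le> z \<longrightarrow> a / 2 * real n \<le> w \<longrightarrow>
    p w \<le> exp (e * (1 + \<bar>z - w\<bar> / (c * natural_scale n))) * p z"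
    unfolding c_def using assms by (intro p_ratio_scale e) auto
  moreover note scaled_tail_prob_le[OF e12] eventually_gt_at_top[of 0]
  ultimately show ?thesis
  proof eventually_elim
    case (elim n)
    define h where "h = natural_scale n"
    have h: "0 < h" "h powr \<kappa> = real n"
      using elim(4) by (auto simp: h_def natural_scale_pos natural_scale_powr)
    have "(K + 1) * h \<le> a / 2 * real n powr (1 - 1 / \<kappa>) * h"
      using elim(1) h by (intro mult_right_mono) auto
    also have "\<dots> = a / 2 * real n"
      using elim(4) by (simp add: h_def natural_scale_def powr_add[symmetric])
    finally have Kh: "K * h + h \<le> a / 2 * real n" by (simp add: distrib_right)
    have Kh0: "0 \<le> K * h" using K h by simp
    show ?case
      unfolding h_def[symmetric]
    proof (intro allI impI)
      fix z j assume z: "a * real n \<le> z" and j: "j \<le> n"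
      let ?I = "\<lambda>s. indicator {w. K < s * (z - w)} :: real \<Rightarrow> ennreal"
      let ?c = "ennreal (E * p z)"
      have pw: "?c \<le> big h w + (?c * ?I (1 / h) w + ?c * ?I (- 1 / h) w)" for w
      proof -
        consider "K * h < z - w" | "K * h < w - z" | "\<bar>z - w\<bar> \<le> K * h" by linarith
        then show ?thesis
        proof cases
          case 1
          then have "K < (z - w) / h" using h by (simp add: pos_less_divide_eq)
          then show ?thesis by (simp add: add_increasing add_increasing2)
        next
          case 2
          have "K < (w - z) / h" using 2 h by (simp add: pos_less_divide_eq)
          also have "(w - z) / h = - 1 / h * (z - w)" by (simp add: diff_divide_distrib)
          finally have "?I (- 1 / h) w = 1" by simp
          then show ?thesis by (simp add: add_increasing)
        next
          case 3
          have zw: "a / 2 * real n \<le> z" "a / 2 * real n \<le> w" "h \<le> w"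
            using z 3 Kh Kh0 h by linarith+
          have "p z \<le> exp (e * (1 + \<bar>w - z\<bar> / (c * h))) * p w"
            using elim(2) zw by (simp add: h_def)
          also have "\<bar>w - z\<bar> / (c * h) \<le> K / c" using 3 c h by (simp add: field_simps)
          then have "e * (1 + \<bar>w - z\<bar> / (c * h)) \<le> e * (1 + K / c)" using e(1) by simp
          then have "exp (e * (1 + \<bar>w - z\<bar> / (c * h))) * p w \<le> exp (\<epsilon> / 4) * p w"
            unfolding e(2) by (intro mult_right_mono) auto
          finally have "E * p z \<le> p w" unfolding E_def exp_minus_mult_le_iff .
          then have "?c \<le> big h w"
            using zw by (simp add: restricted_conv_target_eq ennreal_leI)
          then show ?thesis by (simp add: add_increasing2)
        qed
      qed
      have jn: "real j \<le> h powr \<kappa>" using j h by simp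
      have tail: "real j * prob {y. h < \<bar>y\<bar>} \<le> \<epsilon> / 12"
      proof -
        have "real j * prob {y. h < \<bar>y\<bar>} \<le> real n * prob {y. h < \<bar>y\<bar>}"
          using j by (intro mult_right_mono) auto
        then show ?thesis using elim(3) by (simp add: h_def)
      qed
      have I: "(R {..h} ^^ j) (?I s) z \<le> ennreal (\<epsilon> / 8 + \<epsilon> / 12)" if "\<bar>s\<bar> = 1 / h" for s
      proof -
        have "(R {..h} ^^ j) (?I s) z \<le> (R UNIV ^^ j) (?I s) z"
          by (rule restricted_conv_power_mono) auto
        also have "\<dots> \<le> ennreal (exp (m - K) + real j * prob {y. h < \<bar>y\<bar>})"
          by (rule deviation_le) (use h jn that in auto)
        also have "\<dots> \<le> ennreal (\<epsilon> / 8 + \<epsilon> / 12)"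
          using K(1) tail by (intro ennreal_leI add_mono) auto
        finally show ?thesis .
      qed
      have "emeasure M (- {..h}) \<le> ennreal (prob {y. h < \<bar>y\<bar>})"
        unfolding emeasure_eq_measure[symmetric] by (intro emeasure_mono) auto
      then have "of_nat j * emeasure M (- {..h}) \<le> of_nat j * ennreal (prob {y. h < \<bar>y\<bar>})"
        by (intro mult_left_mono) auto
      also have "\<dots> \<le> ennreal (\<epsilon> / 12)"
        using tail by (simp add: ennreal_of_nat_eq_real_of_nat ennreal_mult'[symmetric] ennreal_leI)
      finally have mass: "of_nat j * emeasure M (- {..h}) \<le> ennreal (\<epsilon> / 12)" .
      have "1 \<le> (R {..h} ^^ j) (\<lambda>_. 1) z + of_nat j * emeasure M (- {..h})"
        using conv_power_le_restricted[of "\<lambda>_. 1" "{..h}" j z] by (simp add: restricted_conv_power_const)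
      also have "\<dots> \<le> (R {..h} ^^ j) (\<lambda>_. 1) z + ennreal (\<epsilon> / 12)"
        by (intro add_left_mono mass)
      finally have "?c * 1 \<le> ?c * ((R {..h} ^^ j) (\<lambda>_. 1) z + ennreal (\<epsilon> / 12))"
        by (rule mult_left_mono) simp
      also have "\<dots> = (R {..h} ^^ j) (\<lambda>_. ?c) z + ?c * ennreal (\<epsilon> / 12)"
        using restricted_conv_power_cmult[of "\<lambda>_. 1" "{..h}" j ?c z] by (simp add: distrib_left)
      also have "(R {..h} ^^ j) (\<lambda>_. ?c) z
          \<le> (R {..h} ^^ j) (\<lambda>w. big h w + (?c * ?I (1 / h) w + ?c * ?I (- 1 / h) w)) z"
        by (rule restricted_conv_power_mono[OF _ pw]) auto
      also have "\<dots> = (R {..h} ^^ j) (big h) z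
          + (?c * (R {..h} ^^ j) (?I (1 / h)) z + ?c * (R {..h} ^^ j) (?I (- 1 / h)) z)"
        by (simp add: restricted_conv_power_add restricted_conv_power_cmult)
      also have "\<dots> \<le> (R {..h} ^^ j) (big h) z
          + (?c * ennreal (\<epsilon> / 8 + \<epsilon> / 12) + ?c * ennreal (\<epsilon> / 8 + \<epsilon> / 12))"
        using h by (intro add_left_mono add_mono mult_left_mono I) auto
      finally have "?c \<le> (R {..h} ^^ j) (big h) z
          + (?c * ennreal (\<epsilon> / 8 + \<epsilon> / 12) + ?c * ennreal (\<epsilon> / 8 + \<epsilon> / 12)) + ?c * ennreal (\<epsilon> / 12)"
        by (simp add: add_right_mono)
      also have "\<dots> = (R {..h} ^^ j) (big h) z
          + ennreal (E * p z * (\<epsilon> / 8 + \<epsilon> / 12) + E * p z * (\<epsilon> / 8 + \<epsilon> / 12) + E * p z * (\<epsilon> / 12))"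
      proof -
        have mult: "?c * ennreal u = ennreal (E * p z * u)" if "0 \<le> u" for u
          using that E by (intro ennreal_mult[symmetric]) auto
        have plus: "ennreal (A + A + B) = (ennreal A + ennreal A) + ennreal B" if "0 \<le> A" "0 \<le> B" for A B
          using that by (subst ennreal_plus, simp, simp, subst ennreal_plus) simp_all
        have "?c * ennreal (\<epsilon> / 8 + \<epsilon> / 12) = ennreal (E * p z * (\<epsilon> / 8 + \<epsilon> / 12))"
          "?c * ennreal (\<epsilon> / 12) = ennreal (E * p z * (\<epsilon> / 12))"
          by (rule mult, use assms in simp)+
        moreover have "ennreal (E * p z * (\<epsilon> / 8 + \<epsilon> / 12) + E * p z * (\<epsilon> / 8 + \<epsilon> / 12) + E * p z * (\<epsilon> / 12))
          = (ennreal (E * p z * (\<epsilon> / 8 + \<epsilon> / 12)) + ennreal (E * p z * (\<epsilon> / 8 + \<epsilon> / 12)))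
            + ennreal (E * p z * (\<epsilon> / 12))"
          using assms E by (intro plus mult_nonneg_nonneg) auto
        ultimately show ?thesis by (simp only: add.assoc)
      qed
      also have "E * p z * (\<epsilon> / 8 + \<epsilon> / 12) + E * p z * (\<epsilon> / 8 + \<epsilon> / 12) + E * p z * (\<epsilon> / 12)
          = E * p z * (\<epsilon> / 2)"
        by (simp add: field_simps)
      finally have main: "?c \<le> (R {..h} ^^ j) (big h) z + ennreal (E * p z * (\<epsilon> / 2))" .
      show "ennreal ((1 - \<epsilon>) * p z) \<le> (R {..h} ^^ j) (big h) z"
      proof (cases "(R {..h} ^^ j) (big h) z")
        case (real r)
        then have "E * p z \<le> r + E * p z * (\<epsilon> / 2)"
          using main assms E by (simp add: ennreal_plus[symmetric] del: ennreal_plus)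
        moreover have "(1 - \<epsilon>) * p z \<le> (E - \<epsilon> / 2) * p z"
          using E(2) assms by (intro mult_right_mono) auto
        moreover have "E * (p z * (\<epsilon> / 2)) \<le> 1 * (p z * (\<epsilon> / 2))"
          using E assms by (intro mult_right_mono) auto
        ultimately have "(1 - \<epsilon>) * p z \<le> r" by (simp add: algebra_simps)
        then show ?thesis using real by (simp add: ennreal_leI)
      qed simp
    qed
  qed
qed

text \<open>A self-reproducing bound for untruncated powers. Splitting off a second jump returns the
  same quantity with factor \<open>e\<close>, and at most n positions with e n \<le> 1/2 turn 4q
  into 2q, leaving 2q for the truncated part.\<close>

lemma big_sum_le:
  assumes "e * real n \<le> 1 / 2" "0 \<le> e" and k: "k \<le> n" and q: "0 \<le> q"
    and one: "\<And>j. j \<le> n \<Longrightarrow> (R {..h} ^^ j) (big h) z \<le> ennreal (2 * q)"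
    and two: "\<And>x. R {h<..} (big h) x \<le> ennreal e * big h x"
  shows "(R UNIV ^^ k) (big h) z \<le> ennreal (4 * q)"
  using k
proof (induction k)
  case 0
  then show ?case using one[of 0] q by (auto intro: order_trans ennreal_leI)
next
  case (Suc j)
  have compl: "- {..h} = {h<..}" by auto
  have "R {h<..} ((R UNIV ^^ j) (big h)) z = (R UNIV ^^ j) (R {h<..} (big h)) z"
    by (subst restricted_conv_power_commute) auto
  also have "\<dots> \<le> (R UNIV ^^ j) (\<lambda>w. ennreal e * big h w) z"
    by (rule restricted_conv_power_mono[OF _ two]) auto
  also have "\<dots> = ennreal e * (R UNIV ^^ j) (big h) z"
    by (rule restricted_conv_power_cmult) auto
  also have "\<dots> \<le> ennreal e * ennreal (4 * q)"
    using Suc by (intro mult_left_mono) auto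
  finally have "of_nat (Suc j) * R {h<..} ((R UNIV ^^ j) (big h)) z \<le> of_nat (Suc j) * (ennreal e * ennreal (4 * q))"
    by (rule mult_left_mono) simp
  also have "\<dots> = ennreal (real (Suc j) * (e * (4 * q)))"
    unfolding ennreal_of_nat_eq_real_of_nat using assms(2) q
    by (simp add: ennreal_mult'[symmetric] del: of_nat_Suc)
  also have "\<dots> \<le> ennreal (2 * q)"
  proof (rule ennreal_leI)
    have "real (Suc j) * e \<le> real n * e" using Suc(2) assms(2) by (intro mult_right_mono) auto
    then have "real (Suc j) * e \<le> 1 / 2" using assms(1) by (simp add: mult.commute)
    then have "(real (Suc j) * e) * (4 * q) \<le> 1 / 2 * (4 * q)" using q by (intro mult_right_mono) auto
    then show "real (Suc j) * (e * (4 * q)) \<le> 2 * q" by (simp add: mult.assoc)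
  qed
  finally have 2: "of_nat (Suc j) * R {h<..} ((R UNIV ^^ j) (big h)) z \<le> ennreal (2 * q)" .
  have "(R UNIV ^^ Suc j) (big h) z
      \<le> (R {..h} ^^ Suc j) (big h) z + of_nat (Suc j) * R {h<..} ((R UNIV ^^ j) (big h)) z"
    using conv_power_le[of "big h" "{..h}" j z] unfolding compl by simp
  also have "\<dots> \<le> ennreal (2 * q) + ennreal (2 * q)"
    by (intro add_mono one 2 Suc)
  also have "\<dots> = ennreal (4 * q)" using q by (simp add: ennreal_plus[symmetric] del: ennreal_plus)
  finally show ?case .
qed

text \<open>The contributions of no, one and at least two jumps are given the errors \<epsilon>/3
  each. In the last one the two jumps are contracted to one by the two-jump estimate, and
  \<open>big_sum_le\<close> controls the remaining free steps.\<close>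

lemma sum_local_prob_upper:
  assumes alt: "Sd H \<or> O_regularly_varying H" and "0 < a" "0 < \<epsilon>"
  shows "\<forall>\<^sub>F n in sequentially. \<forall>z\<ge>a * real n.
    (R UNIV ^^ n) target z \<le> ennreal ((1 + \<epsilon>) * (real n * p z))"
proof -
  \<comment> \<open>1/2 is what \<open>big_sum_le\<close> requires; \<epsilon>/12 compensates for
    its factor 4.\<close>
  define \<eta> where "\<eta> = min (1 / 2) (\<epsilon> / 12)"
  have \<eta>: "0 < \<eta>" "\<eta> \<le> 1 / 2" "\<eta> \<le> \<epsilon> / 12" using assms by (auto simp: \<eta>_def)
  have e3: "0 < \<epsilon> / 3" using assms by simp
  have em: "0 < \<epsilon> / 3 / exp m" using assms by simp
  have "\<forall>\<^sub>F n in sequentially. \<forall>x. R {natural_scale n<..} (big (natural_scale n)) x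
      \<le> ennreal (\<eta> * natural_scale n powr - \<kappa>) * big (natural_scale n) x"
    using two_jumps_negligible[OF alt \<eta>(1)] natural_scale_at_top unfolding filterlim_iff by blast
  moreover note one_jump_upper[OF assms(2) e3] one_jump_upper[OF assms(2) zero_less_one]
    exp_scale_le[OF assms(2) em] eventually_ge_at_top[of 2]
  ultimately show ?thesis
  proof eventually_elim
    case (elim n)
    define h where "h = natural_scale n"
    have n: "2 \<le> n" by fact
    then obtain k where k: "n = Suc (Suc k)" by (metis add_2_eq_Suc le_Suc_ex)
    have h: "0 < h" "h powr \<kappa> = real n"
      using n by (auto simp: h_def natural_scale_pos natural_scale_powr)
    have A: "{y. 1 / h * y \<le> 1} = {..h}" using h by (auto simp: field_simps)
    have compl: "- {..h} = {h<..}" by auto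
    define e where "e = \<eta> * h powr - \<kappa>"
    have e: "0 \<le> e" "e * real n = \<eta>"
      using \<eta> h n by (auto simp: e_def powr_minus)
    have two: "R {h<..} (big h) x \<le> ennreal e * big h x" for x
      using elim(1) by (simp add: h_def e_def)
    show ?case
    proof (intro allI impI)
      fix z assume z: "a * real n \<le> z"
      have z0: "0 < z" using z n assms by (auto intro: less_le_trans[of 0 "a * real n"])
      have "(R UNIV ^^ k) (big h) z \<le> ennreal (4 * p z)"
      proof (rule big_sum_le[where n = n and e = e])
        show "(R {..h} ^^ j) (big h) z \<le> ennreal (2 * p z)" if "j \<le> n" for j
          using elim(3) z that by (simp add: h_def)
      qed (use e \<eta> two k in auto)
      then have "ennreal e * (R UNIV ^^ k) (big h) z \<le> ennreal e * ennreal (4 * p z)"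
        by (rule mult_left_mono) simp
      moreover have "R {h<..} (R {h<..} ((R UNIV ^^ k) target)) z = (R UNIV ^^ k) (R {h<..} (big h)) z"
        by (simp add: restricted_conv_power_commute)
      moreover have "(R UNIV ^^ k) (R {h<..} (big h)) z \<le> (R UNIV ^^ k) (\<lambda>w. ennreal e * big h w) z"
        by (rule restricted_conv_power_mono[OF _ two]) auto
      moreover have "(R UNIV ^^ k) (\<lambda>w. ennreal e * big h w) z = ennreal e * (R UNIV ^^ k) (big h) z"
        by (rule restricted_conv_power_cmult) auto
      ultimately have "R {h<..} (R {h<..} ((R UNIV ^^ k) target)) z \<le> ennreal e * ennreal (4 * p z)"
        by (auto intro: order_trans)
      then have "of_nat n ^ 2 * R {h<..} (R {h<..} ((R UNIV ^^ k) target)) z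
          \<le> of_nat n ^ 2 * (ennreal e * ennreal (4 * p z))"
        by (rule mult_left_mono) simp
      also have "\<dots> = ennreal (real n ^ 2 * (e * (4 * p z)))"
        unfolding ennreal_of_nat_eq_real_of_nat using e by (simp add: ennreal_mult'[symmetric] ennreal_power)
      also have "real n ^ 2 * (e * (4 * p z)) = 4 * \<eta> * (real n * p z)"
        unfolding e(2)[symmetric] by (simp add: power2_eq_square mult_ac)
      finally have t3: "of_nat n ^ 2 * R {h<..} (R {h<..} ((R UNIV ^^ k) target)) z
          \<le> ennreal (4 * \<eta> * (real n * p z))" .
      have "R {h<..} ((R {..h} ^^ Suc k) target) z = (R {..h} ^^ Suc k) (big h) z"
        by (subst restricted_conv_power_commute) auto
      also have "\<dots> \<le> ennreal ((1 + \<epsilon> / 3) * p z)"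
        using elim(2) z k by (simp add: h_def del: funpow.simps)
      finally have "of_nat n * R {h<..} ((R {..h} ^^ Suc k) target) z \<le> of_nat n * ennreal ((1 + \<epsilon> / 3) * p z)"
        by (rule mult_left_mono) simp
      also have "\<dots> = ennreal ((1 + \<epsilon> / 3) * (real n * p z))"
        unfolding ennreal_of_nat_eq_real_of_nat using assms by (simp add: ennreal_mult'[symmetric] mult_ac)
      finally have t2: "of_nat n * R {h<..} ((R {..h} ^^ Suc k) target) z
          \<le> ennreal ((1 + \<epsilon> / 3) * (real n * p z))" .
      \<comment> \<open>\<open>target\<close> lives on w < 0, where this exponential exceeds 1, so
        the exponential moment applies for every T.\<close>
      have "target w \<le> ennreal (exp (- (1 / h) * w))" for w
        using h by (auto simp: target_def Delta_def indicator_def divide_nonpos_pos)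
      then have "(R {..h} ^^ n) target z \<le> (R {..h} ^^ n) (\<lambda>w. ennreal (exp (- (1 / h) * w))) z"
        by (intro restricted_conv_power_mono) auto
      also have "\<dots> \<le> ennreal (exp (- (1 / h) * z) * exp (real n * \<bar>1 / h\<bar> powr \<kappa> * m))"
        using restricted_conv_power_exp_le[where s = "1 / h" and n = n and x = z] unfolding A .
      also have "real n * \<bar>1 / h\<bar> powr \<kappa> * m = m" using h n by (simp add: powr_divide)
      also have "exp (- (1 / h) * z) * exp m \<le> \<epsilon> / 3 * (real n * p z)"
      proof -
        have "exp (- (1 / h) * z) \<le> exp (- (z / (2 * h)))" using z0 h by (simp add: field_simps)
        also have "\<dots> \<le> \<epsilon> / 3 / exp m * p z" using elim(4) z by (simp add: h_def)
        finally have "exp (- (1 / h) * z) * exp m \<le> \<epsilon> / 3 * p z" by (simp add: field_simps)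
        also have "\<dots> \<le> \<epsilon> / 3 * (real n * p z)"
          using n assms mult_right_mono[of 1 "real n" "p z"] by (intro mult_left_mono) auto
        finally show ?thesis .
      qed
      finally have t1: "(R {..h} ^^ n) target z \<le> ennreal (\<epsilon> / 3 * (real n * p z))"
        by (simp add: ennreal_leI)
      have "(R UNIV ^^ n) target z \<le> (R {..h} ^^ n) target z + of_nat n * R {h<..} ((R {..h} ^^ Suc k) target) z
          + of_nat n ^ 2 * R {h<..} (R {h<..} ((R UNIV ^^ k) target)) z"
        using conv_power_le2[of target "{..h}" k z] unfolding compl k by simp
      also have "\<dots> \<le> ennreal (\<epsilon> / 3 * (real n * p z)) + ennreal ((1 + \<epsilon> / 3) * (real n * p z))
          + ennreal (4 * \<eta> * (real n * p z))"
        by (intro add_mono t1 t2 t3)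
      also have "\<dots> = ennreal (\<epsilon> / 3 * (real n * p z) + (1 + \<epsilon> / 3) * (real n * p z) + 4 * \<eta> * (real n * p z))"
        using assms \<eta> by (simp add: ennreal_plus)
      also have "\<dots> \<le> ennreal ((1 + \<epsilon>) * (real n * p z))"
      proof (rule ennreal_leI)
        have "4 * \<eta> * (real n * p z) \<le> \<epsilon> / 3 * (real n * p z)" using \<eta> by (intro mult_right_mono) auto
        then show "\<epsilon> / 3 * (real n * p z) + (1 + \<epsilon> / 3) * (real n * p z) + 4 * \<eta> * (real n * p z)
            \<le> (1 + \<epsilon>) * (real n * p z)"
          by (simp add: algebra_simps)
      qed
      finally show "(R UNIV ^^ n) target z \<le> ennreal ((1 + \<epsilon>) * (real n * p z))" .
    qed
  qed
qed

lemma sum_local_prob_lower: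
  assumes "0 < a" "0 < \<epsilon>"
  shows "\<forall>\<^sub>F n in sequentially. \<forall>z\<ge>a * real n.
    ennreal ((1 - \<epsilon>) * (real n * p z)) \<le> (R UNIV ^^ n) target z"
  using one_jump_lower[OF assms] eventually_gt_at_top[of 0]
proof eventually_elim
  case (elim n)
  then obtain k where k: "n = Suc k" by (metis gr0_conv_Suc)
  define h where "h = natural_scale n"
  have compl: "- {..h} = {h<..}" by auto
  show ?case
  proof (intro allI impI)
    fix z assume z: "a * real n \<le> z"
    have "ennreal ((1 - \<epsilon>) * (real n * p z)) = of_nat n * ennreal ((1 - \<epsilon>) * p z)"
      unfolding ennreal_of_nat_eq_real_of_nat by (simp add: ennreal_mult'[symmetric] mult_ac)
    also have "\<dots> \<le> of_nat n * (R {..h} ^^ k) (big h) z"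
      using elim(1) z k by (intro mult_left_mono) (auto simp: h_def)
    also have "(R {..h} ^^ k) (big h) z = R {h<..} ((R {..h} ^^ k) target) z"
      by (subst restricted_conv_power_commute) auto
    also have "of_nat n * \<dots> \<le> (R UNIV ^^ n) target z"
      using conv_power_ge[of target "{..h}" k z] unfolding compl k by simp
    finally show "ennreal ((1 - \<epsilon>) * (real n * p z)) \<le> (R UNIV ^^ n) target z" .
  qed
qed

end

subsection \<open>Sums of independent variables\<close>

text \<open>Links the operators to random variables: the newest summand is independent of the
  partial sum, so their joint law is a product and Fubini peels off one operator.\<close>

lemma (in prob_space) iid_sum_restricted_conv:
  fixes \<xi> :: "nat \<Rightarrow> 'a \<Rightarrow> real"
  assumes indep: "indep_vars (\<lambda>_. borel) \<xi> {1..}"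
    and F: "\<And>i. 1 \<le> i \<Longrightarrow> distr M borel (\<xi> i) = F"
    and f [measurable]: "f \<in> borel_measurable borel"
  shows "(restricted_conv F UNIV ^^ n) f x = (\<integral>\<^sup>+\<omega>. f (x - (\<Sum>i=1..n. \<xi> i \<omega>)) \<partial>M)"
proof (induction n arbitrary: x)
  case 0
  then show ?case by (simp add: emeasure_space_1)
next
  case (Suc n)
  let ?S = "\<lambda>\<omega>. \<Sum>i=1..n. \<xi> i \<omega>"
  have rv [measurable]: "\<xi> i \<in> borel_measurable M" if "1 \<le> i" for i
    using indep that by (simp add: indep_vars_def)
  have S [measurable]: "?S \<in> borel_measurable M"
    by (intro borel_measurable_sum rv) auto
  have "indep_vars (\<lambda>_. borel) \<xi> (insert (Suc n) {1..n})"
    by (rule indep_vars_subset[OF indep]) auto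
  then have "indep_var borel (\<xi> (Suc n)) borel ?S"
    by (intro indep_vars_sum) auto
  then have prod: "distr M (borel \<Otimes>\<^sub>M borel) (\<lambda>\<omega>. (\<xi> (Suc n) \<omega>, ?S \<omega>)) = F \<Otimes>\<^sub>M distr M borel ?S"
    using F by (simp add: indep_var_distribution_eq)
  have "prob_space (distr M borel ?S)" by (rule prob_space_distr) simp
  then interpret S: prob_space "distr M borel ?S" .
  have F1: "F = distr M borel (\<xi> (Suc n))" using F[of "Suc n"] by simp
  have sets_F [measurable_cong]: "sets F = sets borel" by (simp add: F1)
  have "(restricted_conv F UNIV ^^ Suc n) f x = (\<integral>\<^sup>+y. \<integral>\<^sup>+\<omega>. f (x - y - ?S \<omega>) \<partial>M \<partial>F)"
    by (simp add: restricted_conv_def[of F UNIV "(restricted_conv F UNIV ^^ n) f"] Suc)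
  also have "\<dots> = (\<integral>\<^sup>+y. \<integral>\<^sup>+s. f (x - y - s) \<partial>distr M borel ?S \<partial>F)"
    by (simp add: nn_integral_distr)
  also have "\<dots> = (\<integral>\<^sup>+u. f (x - fst u - snd u) \<partial>(F \<Otimes>\<^sub>M distr M borel ?S))"
    by (subst S.nn_integral_fst[symmetric]) auto
  also have "\<dots> = (\<integral>\<^sup>+\<omega>. f (x - \<xi> (Suc n) \<omega> - ?S \<omega>) \<partial>M)"
    unfolding prod[symmetric] by (subst nn_integral_distr) (auto intro: rv)
  also have "\<dots> = (\<integral>\<^sup>+\<omega>. f (x - (\<Sum>i=1..Suc n. \<xi> i \<omega>)) \<partial>M)"
    by (simp add: algebra_simps)
  finally show ?case .
qed

text \<open>With z = n x the range x \<ge> a becomes z \<ge> a n, on which the upper and lower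
  estimates are already uniform.\<close>

theorem corollary2p1:
  fixes M :: "'a measure" and \<xi> :: "nat \<Rightarrow> 'a \<Rightarrow> real" and F :: "real measure"
    and T :: ereal and \<kappa> a :: real
  assumes "prob_space M"
    and "prob_space.indep_vars M (\<lambda>_. borel) \<xi> {1..}"
    and "\<And>i. 1 \<le> i \<Longrightarrow> distr M borel (\<xi> i) = F"
    and "0 < T"
    and "1 < \<kappa>" and "\<kappa> \<le> 2"
    and "integrable M (\<lambda>\<omega>. \<bar>\<xi> 1 \<omega>\<bar> powr \<kappa>)"
    and "prob_space.expectation M (\<xi> 1) = 0"
    and "almost_decreasing (local_prob F T)"
    and "Sd (\<lambda>x. x powr \<kappa> * local_prob F T x) \<or>
         O_regularly_varying (\<lambda>x. x powr \<kappa> * local_prob F T x)"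
    and "((\<lambda>x. SUP t\<in>{0..x powr (1 / \<kappa>)}.
             ereal \<bar>local_prob F T (x - t) / local_prob F T x - 1\<bar>) \<longlongrightarrow> 0) at_top"
    and "0 < a"
  shows "(\<lambda>n::nat. SUP x\<in>{a..}.
            ereal \<bar>\<P>(\<omega> in M. (\<Sum>i=1..n. \<xi> i \<omega>) \<in> shifted_Delta T (real n * x)) /
                   (real n * \<P>(\<omega> in M. \<xi> 1 \<omega> \<in> shifted_Delta T (real n * x))) - 1\<bar>)
         \<longlonglongrightarrow> 0"
proof -
  interpret P: prob_space M by fact
  have rv [measurable]: "\<xi> i \<in> borel_measurable M" if "1 \<le> i" for i
    using assms(2) that by (simp add: P.indep_vars_def)
  have F1: "distr M borel (\<xi> 1) = F" using assms(3) by simp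
  have rv1 [measurable]: "\<xi> 1 \<in> borel_measurable M" by (rule rv) simp
  have "prob_space F" unfolding F1[symmetric] by (rule P.prob_space_distr) (rule rv1)
  then interpret F: prob_space F .
  interpret big_jump_distribution F \<kappa> T
  proof
    show "sets F = sets borel" unfolding F1[symmetric] by simp
    show "integrable F (\<lambda>x. \<bar>x\<bar> powr \<kappa>)"
      unfolding F1[symmetric] using assms(7) by (subst integrable_distr_eq) auto
    show "F.expectation (\<lambda>x. x) = 0"
      unfolding F1[symmetric] using assms(8) by (subst integral_distr) auto
  qed (use assms in auto)
  have numer: "ennreal \<P>(\<omega> in M. (\<Sum>i=1..n. \<xi> i \<omega>) \<in> shifted_Delta T z) = (R UNIV ^^ n) target z" for n z
  proof -
    have [measurable]: "(\<lambda>\<omega>. \<Sum>i=1..n. \<xi> i \<omega>) \<in> borel_measurable M"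
      by (intro borel_measurable_sum rv) auto
    have "(R UNIV ^^ n) target z = (\<integral>\<^sup>+\<omega>. target (z - (\<Sum>i=1..n. \<xi> i \<omega>)) \<partial>M)"
      by (rule P.iid_sum_restricted_conv[OF assms(2)]) (use assms(3) in auto)
    also have "\<dots> = (\<integral>\<^sup>+\<omega>. indicator {\<omega> \<in> space M. (\<Sum>i=1..n. \<xi> i \<omega>) \<in> shifted_Delta T z} \<omega> \<partial>M)"
      unfolding target_diff
      by (intro nn_integral_cong) (auto simp: indicator_def)
    also have "\<dots> = ennreal \<P>(\<omega> in M. (\<Sum>i=1..n. \<xi> i \<omega>) \<in> shifted_Delta T z)"
      by (subst nn_integral_indicator) (auto simp: P.emeasure_eq_measure)
    finally show ?thesis by simp
  qed
  have denom: "\<P>(\<omega> in M. \<xi> 1 \<omega> \<in> shifted_Delta T z) = p z" for z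
    unfolding local_prob_def F1[symmetric]
    by (subst measure_distr) (auto intro!: arg_cong[where f = "measure M"])
  let ?D = "\<lambda>n x. \<bar>\<P>(\<omega> in M. (\<Sum>i=1..n. \<xi> i \<omega>) \<in> shifted_Delta T (real n * x)) /
                   (real n * \<P>(\<omega> in M. \<xi> 1 \<omega> \<in> shifted_Delta T (real n * x))) - 1\<bar>"
  have le: "\<forall>\<^sub>F n in sequentially. (SUP x\<in>{a..}. ereal (?D n x)) \<le> ereal \<epsilon>"
    if e: "0 < \<epsilon>" "\<epsilon> < 1" for \<epsilon> :: real
  proof -
    obtain x0 where x0: "\<And>w. x0 \<le> w \<Longrightarrow> 0 < p w"
      using p_insensitive[OF zero_less_one] by metis
    have "filterlim (\<lambda>n. a * real n) at_top sequentially"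
      using assms(12) by (intro filterlim_tendsto_pos_mult_at_top[OF tendsto_const _ filterlim_real_sequentially])
    then have "\<forall>\<^sub>F n in sequentially. x0 \<le> a * real n"
      using eventually_ge_at_top unfolding filterlim_iff by blast
    with sum_local_prob_upper[OF assms(10,12) e(1)] sum_local_prob_lower[OF assms(12) e(1)]
      eventually_gt_at_top[of 0]
    show ?thesis
    proof eventually_elim
      case (elim n)
      show ?case
      proof (rule SUP_least)
        fix x assume "x \<in> {a..}"
        then have z: "a * real n \<le> real n * x" using mult_right_mono[of a x "real n"] by (simp add: mult.commute)
        define q where "q = real n * p (real n * x)"
        define S where "S = \<P>(\<omega> in M. (\<Sum>i=1..n. \<xi> i \<omega>) \<in> shifted_Delta T (real n * x))"
        \<comment> \<open>From here on the quotient is a genuine one; division by zero cannot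
          interfere for large n.\<close>
        have q: "0 < q" using x0[of "real n * x"] z elim(4,3) by (simp add: q_def)
        have "ennreal S \<le> ennreal ((1 + \<epsilon>) * q)" "ennreal ((1 - \<epsilon>) * q) \<le> ennreal S"
          unfolding S_def numer q_def using elim(1,2) z by auto
        then have "S \<le> (1 + \<epsilon>) * q" "(1 - \<epsilon>) * q \<le> S"
          using e q by (auto simp: S_def ennreal_le_iff measure_nonneg)
        then have "\<bar>S / q - 1\<bar> \<le> \<epsilon>"
          using q by (simp add: abs_le_iff field_simps)
        then show "ereal (?D n x) \<le> ereal \<epsilon>"
          unfolding denom S_def q_def by simp
      qed
    qed
  qed
  show ?thesis
  proof (rule order_tendstoI)
    fix l :: ereal assume l: "l < 0"
    have "0 \<le> (SUP x\<in>{a..}. ereal (?D n x))" for n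
      by (rule order_trans[OF _ SUP_upper[of a]]) auto
    then show "\<forall>\<^sub>F n in sequentially. l < (SUP x\<in>{a..}. ereal (?D n x))"
      using less_le_trans[OF l] by simp
  next
    fix u :: ereal assume "0 < u"
    then have "0 < min u 1" by simp
    \<comment> \<open>The minimum with 1 provides a real \<epsilon> below 1, also when
      \<open>u\<close> is infinite.\<close>
    then obtain \<epsilon> where "0 < ereal \<epsilon>" "ereal \<epsilon> < min u 1" using ereal_dense2 by blast
    then have e: "0 < \<epsilon>" "\<epsilon> < 1" "ereal \<epsilon> < u" by auto
    show "\<forall>\<^sub>F n in sequentially. (SUP x\<in>{a..}. ereal (?D n x)) < u"
      using le[OF e(1,2)] by eventually_elim (rule le_less_trans[OF _ e(3)])
  qed
qed

end
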